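(* Let $\mathbf{k}=\mathbb{R}$ or $\mathbf{k}=\mathbb{C}$ and $n\geq1$. Let $(G_m)_{m\in\mathbb{N}}$ be a sequence of subgroups of $\mathrm{Bir}(\mathbb{P}^n_{\mathbf{k}})$ that converges to the identity $\mathrm{id}\in\mathrm{Bir}(\mathbb{P}^n_{\mathbf{k}})$ (with respect to the Euclidean topology). Then $G_m=\{\mathrm{id}\}$ for all $m\gg0$.
   Context: A sequence $(G_m)_m$ of subgroups of a topological group $G$ converges to the neutral element $\mathrm{id}$ if for every open neighbourhood $U$ of $\mathrm{id}$ there is $m_0$ with $G_m\subset U$ for all $m>m_0$. Euclidean topology on $\mathrm{Bir}(\mathbb{P}^n_{\mathbf{k}})$: for $d\geq1$, let $W_d(\mathbf{k})$ be the projective space of classes $[h_0:\dots:h_n]$ of non-zero $(n+1)$-tuples of degree-$d$ homogeneous polynomials in $\mathbf{k}[x_0,\dots,x_n]$ modulo scalars; $H_d(\mathbf{k})\subset W_d(\mathbf{k})$ the subset of $h$ whose rational map $\psi_h\colon[x]\dashrightarrow[h_0(x):\dots:h_n(x)]$ is birational; $\pi_d\colon H_d(\mathbf{k})\to\mathrm{Bir}(\mathbb{P}^n_{\mathbf{k}})_{\leq d}$, $h\mapsto\psi_h$, onto the set of maps of degree $\leq d$. $W_d(\mathbf{k})$ carries the Euclidean topology, $H_d(\mathbf{k})$ the subspace topology, $\mathrm{Bir}(\mathbb{P}^n_{\mathbf{k}})_{\leq d}$ the quotient topology via $\pi_d$, and $\mathrm{Bir}(\mathbb{P}^n_{\mathbf{k}})$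 the inductive limit topology of the $\mathrm{Bir}(\mathbb{P}^n_{\mathbf{k}})_{\leq d}$. *)

theory Defs
  imports "HOL-Analysis.Analysis" "HOL-Algebra.Group"
begin

text \<open>Coefficient tuples: component i (for i \<le> n) is a homogeneous polynomial
  in x_0..x_n, given by its coefficients indexed by exponent vectors.\<close>
type_synonym 'a tup = "nat \<Rightarrow> (nat \<Rightarrow> nat) \<Rightarrow> 'a"
type_synonym 'a bir = "(nat \<times> 'a tup) set"

definition mons :: "nat \<Rightarrow> nat \<Rightarrow> (nat \<Rightarrow> nat) set" where
  "mons n d = {\<alpha>. (\<forall>i>n. \<alpha> i = 0) \<and> (\<Sum>i\<le>n. \<alpha> i) = d}"

definition peval :: "nat \<Rightarrow> nat \<Rightarrow> ((nat \<Rightarrow> nat) \<Rightarrow> 'a::field) \<Rightarrow> (nat \<Rightarrow> 'a) \<Rightarrow> 'a" where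
  "peval n d p x = (\<Sum>\<alpha>\<in>mons n d. p \<alpha> * (\<Prod>i\<le>n. x i ^ \<alpha> i))"

definition tup_eval :: "nat \<Rightarrow> nat \<Rightarrow> 'a::field tup \<Rightarrow> (nat \<Rightarrow> 'a) \<Rightarrow> (nat \<Rightarrow> 'a)" where
  "tup_eval n d h x = (\<lambda>i. if i \<le> n then peval n d (h i) x else 0)"

definition coeff_tup :: "nat \<Rightarrow> nat \<Rightarrow> 'a::zero tup \<Rightarrow> bool" where
  "coeff_tup n d h \<longleftrightarrow> (\<forall>i \<alpha>. (n < i \<or> \<alpha> \<notin> mons n d) \<longrightarrow> h i \<alpha> = 0)"

definition propto :: "nat \<Rightarrow> ((nat \<Rightarrow> 'a::field) \<Rightarrow> (nat \<Rightarrow> 'a)) \<Rightarrow> ((nat \<Rightarrow> 'a) \<Rightarrow> (nat \<Rightarrow> 'a)) \<Rightarrow> bool" where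
  "propto n F G \<longleftrightarrow> (\<forall>x i j. i \<le> n \<longrightarrow> j \<le> n \<longrightarrow> F x i * G x j = F x j * G x i)"

definition nonzero_map :: "nat \<Rightarrow> ((nat \<Rightarrow> 'a::zero) \<Rightarrow> (nat \<Rightarrow> 'a)) \<Rightarrow> bool" where
  "nonzero_map n F \<longleftrightarrow> (\<exists>x i. i \<le> n \<and> F x i \<noteq> 0)"

text \<open>h \<in> (cone over) H_d: the rational map psi_h is birational, i.e. there is g with
  psi_g o psi_h = id and psi_h o psi_g = id as rational maps.\<close>
definition birational :: "nat \<Rightarrow> nat \<Rightarrow> 'a::field tup \<Rightarrow> bool" where
  "birational n d h \<longleftrightarrow> 1 \<le> d \<and> coeff_tup n d h \<and>
     (\<exists>e g. 1 \<le> e \<and> coeff_tup n e g \<and>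
        nonzero_map n (tup_eval n e g \<circ> tup_eval n d h) \<and>
        propto n (tup_eval n e g \<circ> tup_eval n d h) id \<and>
        nonzero_map n (tup_eval n d h \<circ> tup_eval n e g) \<and>
        propto n (tup_eval n d h \<circ> tup_eval n e g) id)"

definition Hhat :: "nat \<Rightarrow> nat \<Rightarrow> 'a::field tup set" where
  "Hhat n d = {h. birational n d h}"

text \<open>The element psi_h of Bir(P^n): the class of all representatives defining the same map.\<close>
definition bclass :: "nat \<Rightarrow> nat \<Rightarrow> 'a::field tup \<Rightarrow> 'a bir" where
  "bclass n d h = {(e, g). birational n e g \<and> propto n (tup_eval n e g) (tup_eval n d h)}"

definition Bir :: "nat \<Rightarrow> 'a::field bir set" where
  "Bir n = {bclass n d h | d h. birational n d h}"

definition bid :: "nat \<Rightarrow> 'a::field bir" where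
  "bid n = {(e, g). birational n e g \<and> propto n (tup_eval n e g) id}"

definition bcomp :: "nat \<Rightarrow> 'a::field bir \<Rightarrow> 'a bir \<Rightarrow> 'a bir" where
  "bcomp n a b = {(e, f). birational n e f \<and>
      (\<exists>d h d' g. (d, h) \<in> a \<and> (d', g) \<in> b \<and>
         propto n (tup_eval n e f) (tup_eval n d h \<circ> tup_eval n d' g))}"

definition BirG :: "nat \<Rightarrow> 'a::field bir monoid" where
  "BirG n = \<lparr>carrier = Bir n, mult = bcomp n, one = bid n\<rparr>"

text \<open>Euclidean topology: U open iff for every d its preimage in H_d is open. Here
  H_d is taken on the (scaling-invariant) cone in the finite-dimensional coefficient
  space, whose topology is the product topology restricted to coefficient tuples.\<close>
definition bir_open :: "nat \<Rightarrow> 'a::{field,topological_space} bir set \<Rightarrow> bool" where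
  "bir_open n U \<longleftrightarrow> U \<subseteq> Bir n \<and>
     (\<forall>d\<ge>1. openin (subtopology euclidean (Hhat n d)) {h \<in> Hhat n d. bclass n d h \<in> U})"

definition converges_to_id :: "nat \<Rightarrow> (nat \<Rightarrow> 'a::{field,topological_space} bir set) \<Rightarrow> bool" where
  "converges_to_id n G \<longleftrightarrow>
     (\<forall>U. bir_open n U \<and> bid n \<in> U \<longrightarrow> (\<exists>m0. \<forall>m>m0. G m \<subseteq> U))"

end

theory Submission
  imports Defs "HOL-Computational_Algebra.Polynomial"
begin

text \<open>
  Elements of \<open>G\<^sub>m\<close> have degree at most some \<open>D\<close> for large \<open>m\<close>, since otherwise one finds a sequence
  of elements whose range is finite in each degree and hence closed. Likewise every nonzero limit of
  normalised representatives of elements of \<open>G\<^sub>m\<close> is a multiple of the identity. Measure the distance of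
  a representative \<open>h\<close> to the identity by the size \<open>\<delta>(h)\<close> of the coefficients of \<open>x\<^sub>0 h\<^sub>i - x\<^sub>i h\<^sub>0\<close>. If
  \<open>G\<^sub>m\<close> is nontrivial infinitely often, choose \<open>g\<^sub>m \<in> G\<^sub>m\<close> with \<open>\<delta>\<close> at least half the supremum over \<open>G\<^sub>m\<close>
  and pass to limits \<open>h\<close> of representatives and \<open>q\<close> of the rescaled forms. Near a generic point \<open>g\<^sub>m\<^sup>K\<close>
  moves \<open>K\<close> times as far as \<open>g\<^sub>m\<close>, so the corresponding limits \<open>A\<close> and \<open>Q\<close> for \<open>g\<^sub>m\<^sup>K\<close> satisfy
  \<open>h\<^sub>0 Q\<^sub>i = K A\<^sub>0 q\<^sub>i\<close>, where \<open>Q\<close> is bounded independently of \<open>K\<close> and \<open>A\<close> has norm one.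
  For \<open>K \<rightarrow> \<infinity>\<close> this yields nonzero polynomials with product zero.
\<close>

section \<open>Polynomial functions\<close>

text \<open>Polynomial functions are kept apart from coefficient families, so that composites and
  iterates of tuples can be handled without computing their coefficients. Coordinates of index above
  \<open>n\<close> are allowed as well.\<close>

inductive_set polyfun :: "((nat \<Rightarrow> 'a::field) \<Rightarrow> 'a) set" where
  const: "(\<lambda>x. c) \<in> polyfun"
| coord: "(\<lambda>x. x i) \<in> polyfun"
| add: "f \<in> polyfun \<Longrightarrow> g \<in> polyfun \<Longrightarrow> (\<lambda>x. f x + g x) \<in> polyfun"
| mult: "f \<in> polyfun \<Longrightarrow> g \<in> polyfun \<Longrightarrow> (\<lambda>x. f x * g x) \<in> polyfun"

lemma polyfun_diff:
  assumes "f \<in> polyfun" "g \<in> polyfun"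
  shows "(\<lambda>x. f x - g x) \<in> polyfun"
  using polyfun.add[OF assms(1) polyfun.mult[OF polyfun.const[of "-1"] assms(2)]] by simp

lemma polyfun_power: "f \<in> polyfun \<Longrightarrow> (\<lambda>x. f x ^ k) \<in> polyfun"
  by (induction k) (simp_all add: polyfun.const polyfun.mult)

lemma polyfun_sum: "(\<And>a. a \<in> A \<Longrightarrow> f a \<in> polyfun) \<Longrightarrow> (\<lambda>x. \<Sum>a\<in>A. f a x) \<in> polyfun"
  by (induction A rule: infinite_finite_induct) (simp_all add: polyfun.const polyfun.add)

lemma polyfun_prod: "(\<And>a. a \<in> A \<Longrightarrow> f a \<in> polyfun) \<Longrightarrow> (\<lambda>x. \<Prod>a\<in>A. f a x) \<in> polyfun"
  by (induction A rule: infinite_finite_induct) (simp_all add: polyfun.const polyfun.mult)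

lemma polyfun_compose:
  assumes "f \<in> polyfun" "\<And>i. (\<lambda>x. F x i) \<in> polyfun"
  shows "(\<lambda>x. f (F x)) \<in> polyfun"
  using assms(1) by induction (simp_all add: polyfun.const polyfun.add polyfun.mult assms(2))

text \<open>Restriction to a line turns nonvanishing in many variables into nonvanishing of a
  univariate polynomial.\<close>

lemma polyfun_line:
  assumes "f \<in> polyfun"
  shows "\<exists>p. \<forall>t. f (\<lambda>i. x i + t * (y i - x i)) = poly p t"
  using assms
proof induction
  case (const c)
  show ?case by (rule exI[of _ "[:c:]"]) simp
next
  case (coord i)
  show ?case by (rule exI[of _ "[:x i, y i - x i:]"]) simp
next
  case (add f g)
  then obtain p q where "\<forall>t. f (\<lambda>i. x i + t * (y i - x i)) = poly p t"
    "\<forall>t. g (\<lambda>i. x i + t * (y i - x i)) = poly q t" by blast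
  then show ?case by (intro exI[of _ "p + q"]) simp
next
  case (mult f g)
  then obtain p q where "\<forall>t. f (\<lambda>i. x i + t * (y i - x i)) = poly p t"
    "\<forall>t. g (\<lambda>i. x i + t * (y i - x i)) = poly q t" by blast
  then show ?case by (intro exI[of _ "p * q"]) simp
qed

text \<open>Restrict to the line through the two points where the factors do not vanish.\<close>
lemma polyfun_common_nonzero:
  fixes f g :: "(nat \<Rightarrow> 'a::field_char_0) \<Rightarrow> 'a"
  assumes "f \<in> polyfun" "g \<in> polyfun" "f x \<noteq> 0" "g y \<noteq> 0"
  shows "\<exists>z. f z \<noteq> 0 \<and> g z \<noteq> 0"
proof -
  obtain p where p: "\<And>t. f (\<lambda>i. x i + t * (y i - x i)) = poly p t"
    using polyfun_line[OF assms(1)] by blast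
  obtain q where q: "\<And>t. g (\<lambda>i. x i + t * (y i - x i)) = poly q t"
    using polyfun_line[OF assms(2)] by blast
  have "poly p 0 \<noteq> 0" "poly q 1 \<noteq> 0"
    using p[of 0] q[of 1] assms(3,4) by simp_all
  then have "p * q \<noteq> 0" by auto
  then obtain t where "poly (p * q) t \<noteq> 0"
    using poly_all_0_iff_0 by blast
  then have "poly p t \<noteq> 0" "poly q t \<noteq> 0" by simp_all
  then show ?thesis using p[of t] q[of t] by (intro exI[of _ "\<lambda>i. x i + t * (y i - x i)"]) simp
qed

definition polymap :: "((nat \<Rightarrow> 'a::field) \<Rightarrow> nat \<Rightarrow> 'a) \<Rightarrow> bool" where
  "polymap F \<longleftrightarrow> (\<forall>i. (\<lambda>x. F x i) \<in> polyfun)"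

lemma polymap_id: "polymap id"
  by (simp add: polymap_def polyfun.coord)

lemma polymap_comp: "polymap F \<Longrightarrow> polymap G \<Longrightarrow> polymap (F \<circ> G)"
  using polyfun_compose[of "\<lambda>y. F y i" G for i] by (simp add: polymap_def)

lemma polymap_funpow:
  assumes "polymap F"
  shows "polymap (F ^^ k)"
  by (induction k) (simp_all only: funpow.simps polymap_comp[OF assms] polymap_id)

lemma polymap_tup_eval: "polymap (tup_eval n d h)"
  unfolding polymap_def
proof
  fix i
  show "(\<lambda>x. tup_eval n d h x i) \<in> polyfun"
    by (cases "i \<le> n") (auto simp: tup_eval_def peval_def
        intro!: polyfun_sum polyfun_prod polyfun_power polyfun.intros)
qed

section \<open>Proportionality\<close>

text \<open>Pointwise proportionality as the vanishing of all 2x2 minors. The zero vector is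
  parallel to everything, so transitivity needs a nonzero middle vector.\<close>

definition parallel :: "nat \<Rightarrow> (nat \<Rightarrow> 'a::field) \<Rightarrow> (nat \<Rightarrow> 'a) \<Rightarrow> bool" where
  "parallel n u v \<longleftrightarrow> (\<forall>i\<le>n. \<forall>j\<le>n. u i * v j = u j * v i)"

lemma propto_iff: "propto n F G \<longleftrightarrow> (\<forall>x. parallel n (F x) (G x))"
  by (auto simp: propto_def parallel_def)

lemma parallel_sym: "parallel n u v \<Longrightarrow> parallel n v u"
  unfolding parallel_def by (metis mult.commute)

lemma propto_sym: "propto n F G \<Longrightarrow> propto n G F"
  using parallel_sym by (auto simp: propto_iff)

lemma propto_refl: "propto n F F"
  by (auto simp: propto_def)

lemma parallel_scale:
  assumes "parallel n u v" "j \<le> n" "v j \<noteq> 0" "i \<le> n"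
  shows "u i = u j / v j * v i"
proof -
  have "u i * v j = u j * v i" using assms by (simp add: parallel_def)
  then show ?thesis using assms(3) by (simp add: field_simps)
qed

lemma parallel_trans:
  assumes "parallel n u v" "parallel n v w" "j \<le> n" "v j \<noteq> 0"
  shows "parallel n u w"
  unfolding parallel_def
proof (intro allI impI)
  fix i k assume "i \<le> n" "k \<le> n"
  then have "u i = u j / v j * v i" "u k = u j / v j * v k" "w i = w j / v j * v i" "w k = w j / v j * v k"
    using parallel_scale[OF assms(1,3,4)] parallel_scale[OF parallel_sym[OF assms(2)] assms(3,4)]
    by blast+
  then show "u i * w k = u k * w i" by (simp only: mult_ac)
qed

text \<open>Pointwise transitivity may fail where \<open>G\<close> vanishes. A minor of
  \<open>F\<close> and \<open>H\<close> that is nonzero somewhere is however nonzero at some point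
  where \<open>G\<close> does not vanish either, and there the pointwise argument gives a
  contradiction.\<close>

lemma propto_trans:
  fixes F G H :: "(nat \<Rightarrow> 'a::field_char_0) \<Rightarrow> nat \<Rightarrow> 'a"
  assumes "polymap F" "polymap G" "polymap H" "propto n F G" "propto n G H" "nonzero_map n G"
  shows "propto n F H"
proof -
  obtain y l where l: "l \<le> n" "G y l \<noteq> 0" using assms(6) by (auto simp: nonzero_map_def)
  have "F x i * H x j - F x j * H x i = 0" if "i \<le> n" "j \<le> n" for x i j
  proof (rule ccontr)
    assume nz: "F x i * H x j - F x j * H x i \<noteq> 0"
    have "(\<lambda>x. F x i * H x j - F x j * H x i) \<in> polyfun" "(\<lambda>x. G x l) \<in> polyfun"
      using assms(1,2,3) by (auto simp: polymap_def intro!: polyfun_diff polyfun.mult)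
    from polyfun_common_nonzero[OF this nz l(2)]
    obtain z where z: "F z i * H z j - F z j * H z i \<noteq> 0" "G z l \<noteq> 0" by auto
    have "parallel n (F z) (H z)"
      using assms(4,5) parallel_trans[of n "F z" "G z" "H z" l] l(1) z(2) by (simp add: propto_iff)
    then show False using z(1) that by (auto simp: parallel_def)
  qed
  then show ?thesis by (auto simp: propto_def)
qed

section \<open>Homogeneity of coefficient tuples\<close>

lemma peval_homogeneous:
  assumes "\<And>i. i \<le> n \<Longrightarrow> y i = c * x i"
  shows "peval n d p y = c ^ d * peval n d p x"
proof -
  have "(\<Prod>i\<le>n. y i ^ \<alpha> i) = c ^ d * (\<Prod>i\<le>n. x i ^ \<alpha> i)" if "\<alpha> \<in> mons n d" for \<alpha>
  proof -
    have "(\<Prod>i\<le>n. y i ^ \<alpha> i) = (\<Prod>i\<le>n. c ^ \<alpha> i * x i ^ \<alpha> i)"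
      by (rule prod.cong) (auto simp: assms power_mult_distrib)
    also have "\<dots> = c ^ (\<Sum>i\<le>n. \<alpha> i) * (\<Prod>i\<le>n. x i ^ \<alpha> i)"
      by (simp add: prod.distrib power_sum)
    finally show ?thesis using that by (simp add: mons_def)
  qed
  then show ?thesis
    by (auto simp: peval_def sum_distrib_left algebra_simps intro!: sum.cong)
qed

lemma tup_eval_homogeneous:
  assumes "\<And>i. i \<le> n \<Longrightarrow> y i = c * x i"
  shows "tup_eval n d h y i = c ^ d * tup_eval n d h x i"
  using peval_homogeneous[OF assms] by (simp add: tup_eval_def)

lemma tup_eval_zero:
  assumes "\<And>i. i \<le> n \<Longrightarrow> y i = 0" "1 \<le> d"
  shows "tup_eval n d h y i = 0"
  using tup_eval_homogeneous[of n y 0 y d h i] assms by (simp add: power_0_left)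

text \<open>A scalar factor comes out as its \<open>d\<close>-th power. If \<open>v\<close> is zero,
  positive degree makes the value at \<open>v\<close> zero, which is parallel to everything.\<close>

lemma parallel_tup_eval:
  assumes "parallel n u v" "1 \<le> d"
  shows "parallel n (tup_eval n d h u) (tup_eval n d h v)"
proof (cases "\<exists>j\<le>n. v j \<noteq> 0")
  case True
  then obtain j where j: "j \<le> n" "v j \<noteq> 0" by blast
  show ?thesis
    unfolding parallel_def
    using tup_eval_homogeneous[of n u "u j / v j" v, OF parallel_scale[OF assms(1) j]]
    by (simp add: mult_ac)
next
  case False
  then have "tup_eval n d h v i = 0" for i using tup_eval_zero assms(2) by blast
  then show ?thesis by (simp add: parallel_def)
qed

section \<open>Birational tuples and their classes\<close>

lemma birational_degree: "birational n d h \<Longrightarrow> 1 \<le> d"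
  by (simp add: birational_def)

text \<open>Forms of positive degree vanish at the origin, so an identically zero \<open>h\<close>
  would make its composite with the inverse zero.\<close>

lemma birational_nonzero:
  assumes "birational n d h"
  shows "nonzero_map n (tup_eval n d h)"
proof -
  obtain e g where e: "1 \<le> e" and nz: "nonzero_map n (tup_eval n e g \<circ> tup_eval n d h)"
    using assms by (auto simp: birational_def)
  show ?thesis
  proof (rule ccontr)
    assume "\<not> nonzero_map n (tup_eval n d h)"
    then have "tup_eval n e g (tup_eval n d h x) i = 0" for x i
      by (intro tup_eval_zero[OF _ e]) (auto simp: nonzero_map_def)
    then show False using nz by (auto simp: nonzero_map_def)
  qed
qed

text \<open>Birational maps are dominant. With \<open>F\<close> the composite of \<open>h\<close>
  after its inverse, a generic \<open>z\<close> is a multiple of \<open>F z\<close>; by homogeneity,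
  if \<open>f\<close> is nonzero at \<open>z\<close> then it is nonzero at \<open>F z\<close>, which
  lies in the image of \<open>h\<close>.\<close>

lemma nonzero_map_comp_birational:
  fixes h :: "'a::field_char_0 tup"
  assumes "nonzero_map n (tup_eval n e f)" "birational n d h"
  shows "nonzero_map n (tup_eval n e f \<circ> tup_eval n d h)"
proof -
  obtain e' g where nz: "nonzero_map n (tup_eval n d h \<circ> tup_eval n e' g)"
    and pr: "propto n (tup_eval n d h \<circ> tup_eval n e' g) id"
    using assms(2) by (auto simp: birational_def)
  obtain x i where x: "i \<le> n" "tup_eval n e f x i \<noteq> 0" using assms(1) by (auto simp: nonzero_map_def)
  define F where "F = tup_eval n d h \<circ> tup_eval n e' g"
  obtain y j where y: "j \<le> n" "F y j \<noteq> 0" using nz by (auto simp: nonzero_map_def F_def)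
  have pF: "polymap F" unfolding F_def by (intro polymap_comp polymap_tup_eval)
  have "(\<lambda>x. tup_eval n e f x i) \<in> polyfun" "(\<lambda>x. F x j) \<in> polyfun"
    using pF polymap_tup_eval[of n e f] by (auto simp: polymap_def)
  from polyfun_common_nonzero[OF this x(2) y(2)]
  obtain z where z: "tup_eval n e f z i \<noteq> 0" "F z j \<noteq> 0" by auto
  have par: "parallel n z (F z)"
    using pr propto_sym by (fastforce simp: propto_iff F_def[symmetric])
  have "tup_eval n e f z i = (z j / F z j) ^ e * tup_eval n e f (F z) i"
    using parallel_scale[OF par y(1) z(2)] by (intro tup_eval_homogeneous) auto
  then have "tup_eval n e f (F z) i \<noteq> 0" using z by auto
  then show ?thesis using x(1) by (auto simp: nonzero_map_def F_def)
qed

lemma bclass_eq: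
  fixes h :: "'a::field_char_0 tup"
  assumes "birational n d h" "birational n e g" "propto n (tup_eval n e g) (tup_eval n d h)"
  shows "bclass n e g = bclass n d h"
  unfolding bclass_def
  using propto_trans[OF polymap_tup_eval polymap_tup_eval polymap_tup_eval
      _ assms(3) birational_nonzero[OF assms(2)]]
    propto_trans[OF polymap_tup_eval polymap_tup_eval polymap_tup_eval
      _ propto_sym[OF assms(3)] birational_nonzero[OF assms(1)]]
  by blast

lemma bclass_refl: "birational n d h \<Longrightarrow> (d, h) \<in> bclass n d h"
  by (simp add: bclass_def propto_refl)

lemma Bir_memD:
  fixes b :: "'a::field_char_0 bir"
  assumes "b \<in> Bir n" "(d, h) \<in> b"
  shows "birational n d h" "b = bclass n d h"
proof -
  obtain e g where b: "b = bclass n e g" "birational n e g" using assms(1) by (auto simp: Bir_def)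
  with assms(2) show h: "birational n d h" by (auto simp: bclass_def)
  show "b = bclass n d h"
    using b h assms(2) bclass_eq[of n e g d h] by (auto simp: bclass_def)
qed

lemma Bir_nonempty: "b \<in> Bir n \<Longrightarrow> \<exists>d h. (d, h) \<in> b"
  by (auto simp: Bir_def dest: bclass_refl)

lemma nonzero_map_id: "nonzero_map n (id :: (nat \<Rightarrow> 'a::field_char_0) \<Rightarrow> _)"
  unfolding nonzero_map_def by (rule exI[of _ "\<lambda>_. 1"]) auto

lemma bclass_eq_bid:
  fixes h :: "'a::field_char_0 tup"
  assumes "birational n d h" "propto n (tup_eval n d h) id"
  shows "bclass n d h = bid n"
  unfolding bclass_def bid_def
  using propto_trans[OF polymap_tup_eval polymap_tup_eval polymap_id _ assms(2) birational_nonzero[OF assms(1)]]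
    propto_trans[OF polymap_tup_eval polymap_id polymap_tup_eval _ propto_sym[OF assms(2)] nonzero_map_id]
  by blast

text \<open>A direct recursion instead of \<open>[^]\<close>, which would require \<open>BirG n\<close> to be known to be a group.\<close>
primrec bpow :: "nat \<Rightarrow> 'a::field bir \<Rightarrow> nat \<Rightarrow> 'a bir" where
  "bpow n b 0 = bid n"
| "bpow n b (Suc k) = bcomp n b (bpow n b k)"

text \<open>A product in \<open>bcomp\<close> may be formed from any representatives. Replacing
  these one at a time by \<open>h\<close> and by its iterate changes the composite only up to
  proportionality; the nonvanishing required by transitivity comes from dominance.\<close>

lemma bpow_rep:
  fixes h :: "'a::field_char_0 tup"
  assumes h: "birational n d h" and Bir: "\<And>j. bpow n (bclass n d h) j \<in> Bir n"
    and f: "(e, f) \<in> bpow n (bclass n d h) k"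
  shows "propto n (tup_eval n e f) (tup_eval n d h ^^ k)"
  using f
proof (induction k arbitrary: e f)
  case 0
  then show ?case by (simp add: bid_def flip: id_def)
next
  case (Suc k)
  then obtain d1 h1 d2 g where
    h1: "(d1, h1) \<in> bclass n d h" and g: "(d2, g) \<in> bpow n (bclass n d h) k"
    and pr: "propto n (tup_eval n e f) (tup_eval n d1 h1 \<circ> tup_eval n d2 g)"
    by (auto simp: bcomp_def)
  have bg: "birational n d2 g" using Bir_memD(1)[OF Bir g] .
  have bh1: "birational n d1 h1" and ph1: "propto n (tup_eval n d1 h1) (tup_eval n d h)"
    using h1 by (auto simp: bclass_def)
  have 1: "propto n (tup_eval n d1 h1 \<circ> tup_eval n d2 g) (tup_eval n d h \<circ> tup_eval n d2 g)"
    using ph1 by (simp add: propto_def)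
  \<comment> \<open>Here the proportional maps sit inside \<open>h\<close>, and homogeneity of
    positive degree carries the proportionality outward.\<close>
  have 2: "propto n (tup_eval n d h \<circ> tup_eval n d2 g) (tup_eval n d h \<circ> tup_eval n d h ^^ k)"
    using Suc.IH[OF g] birational_degree[OF h] by (simp add: propto_iff parallel_tup_eval)
  note pm = polymap_comp[OF polymap_tup_eval polymap_tup_eval]
  have 3: "propto n (tup_eval n e f) (tup_eval n d h \<circ> tup_eval n d2 g)"
    by (rule propto_trans[OF polymap_tup_eval pm pm pr 1])
       (intro nonzero_map_comp_birational birational_nonzero bh1 bg)
  show ?case unfolding funpow.simps
    by (rule propto_trans[OF polymap_tup_eval pm polymap_comp[OF polymap_tup_eval polymap_funpow] 3 2])
       (intro nonzero_map_comp_birational birational_nonzero h bg polymap_tup_eval)+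
qed

text \<open>The inverse of \<open>h\<close> also inverts the scaled tuple, because both composites
  are only multiplied by powers of \<open>c\<close>. This is what permits normalising
  representatives.\<close>

lemma birational_scale:
  fixes h :: "'a::field_char_0 tup"
  assumes h: "birational n d h" and c: "c \<noteq> 0"
  shows "birational n d (\<lambda>i \<alpha>. c * h i \<alpha>)"
    and "bclass n d (\<lambda>i \<alpha>. c * h i \<alpha>) = bclass n d h"
proof -
  let ?h = "\<lambda>i \<alpha>. c * h i \<alpha>"
  have ev: "tup_eval n d ?h x i = c * tup_eval n d h x i" for x i
    by (simp add: tup_eval_def peval_def sum_distrib_left mult.assoc)
  obtain e g where g: "1 \<le> e" "coeff_tup n e g"
        "nonzero_map n (tup_eval n e g \<circ> tup_eval n d h)"
        "propto n (tup_eval n e g \<circ> tup_eval n d h) id"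
        "nonzero_map n (tup_eval n d h \<circ> tup_eval n e g)"
        "propto n (tup_eval n d h \<circ> tup_eval n e g) id"
    using h by (auto simp: birational_def)
  have ev2: "tup_eval n e g (tup_eval n d ?h x) i = c ^ e * tup_eval n e g (tup_eval n d h x) i" for x i
    by (rule tup_eval_homogeneous) (rule ev)
  show b: "birational n d ?h"
    unfolding birational_def
  proof (intro conjI exI[of _ e] exI[of _ g])
    show "1 \<le> d" "coeff_tup n d ?h" using h by (auto simp: birational_def coeff_tup_def)
    show "1 \<le> e" "coeff_tup n e g" using g by auto
    show "nonzero_map n (tup_eval n e g \<circ> tup_eval n d ?h)"
      "propto n (tup_eval n e g \<circ> tup_eval n d ?h) id"
      "nonzero_map n (tup_eval n d ?h \<circ> tup_eval n e g)"
      "propto n (tup_eval n d ?h \<circ> tup_eval n e g) id"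
      using g(3-6) c by (auto simp: nonzero_map_def propto_def ev ev2)
  qed
  show "bclass n d ?h = bclass n d h"
    by (rule bclass_eq[OF h b]) (simp add: propto_def ev)
qed

section \<open>Polynomials of bounded degree\<close>

definition expts :: "nat \<Rightarrow> nat \<Rightarrow> (nat \<Rightarrow> nat) set" where
  "expts n D = {\<alpha>. (\<forall>i>n. \<alpha> i = 0) \<and> (\<Sum>i\<le>n. \<alpha> i) \<le> D}"

definition pval :: "nat \<Rightarrow> nat \<Rightarrow> ((nat \<Rightarrow> nat) \<Rightarrow> 'a::field) \<Rightarrow> (nat \<Rightarrow> 'a) \<Rightarrow> 'a" where
  "pval n D p x = (\<Sum>\<alpha>\<in>expts n D. p \<alpha> * (\<Prod>i\<le>n. x i ^ \<alpha> i))"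

lemma finite_expts: "finite (expts n D)"
proof (rule finite_subset)
  show "finite {\<alpha>. \<forall>i. (i \<in> {..n} \<longrightarrow> \<alpha> i \<in> {..D}) \<and> (i \<notin> {..n} \<longrightarrow> \<alpha> i = 0)}"
    by (rule finite_set_of_finite_funs) auto
  have "\<alpha> i \<le> D" if "(\<Sum>i\<le>n. \<alpha> i) \<le> D" "i \<le> n" for \<alpha> :: "nat \<Rightarrow> nat" and i
    using member_le_sum[of i "{..n}" \<alpha>] that by simp
  then show "expts n D \<subseteq> {\<alpha>. \<forall>i. (i \<in> {..n} \<longrightarrow> \<alpha> i \<in> {..D}) \<and> (i \<notin> {..n} \<longrightarrow> \<alpha> i = 0)}"
    by (auto simp: expts_def)
qed

lemma peval_eq_pval:
  assumes "coeff_tup n d h" "d \<le> D"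
  shows "peval n d (h i) x = pval n D (h i) x"
  unfolding peval_def pval_def
proof (rule sum.mono_neutral_left)
  show "mons n d \<subseteq> expts n D" using assms(2) by (auto simp: mons_def expts_def)
  show "\<forall>\<alpha>\<in>expts n D - mons n d. h i \<alpha> * (\<Prod>i\<le>n. x i ^ \<alpha> i) = 0"
    using assms(1) by (simp add: coeff_tup_def)
qed (rule finite_expts)

lemma polyfun_pval: "pval n D p \<in> polyfun"
proof -
  have "(\<lambda>x. \<Sum>\<alpha>\<in>expts n D. p \<alpha> * (\<Prod>i\<le>n. x i ^ \<alpha> i)) \<in> polyfun"
    by (intro polyfun_sum polyfun_prod polyfun_power polyfun.mult polyfun.const polyfun.coord)
  then show ?thesis by (simp add: pval_def[abs_def])
qed

text \<open>Artin's independence of characters, for the multiplicative functions \<open>x\<^sup>\<alpha>\<close>.\<close>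
lemma monomials_independent:
  fixes c :: "(nat \<Rightarrow> nat) \<Rightarrow> 'a::field_char_0"
  assumes "finite M" "\<And>\<alpha> i. \<alpha> \<in> M \<Longrightarrow> n < i \<Longrightarrow> \<alpha> i = 0"
    "\<And>x. (\<Sum>\<alpha>\<in>M. c \<alpha> * (\<Prod>i\<le>n. x i ^ \<alpha> i)) = 0" "\<alpha> \<in> M"
  shows "c \<alpha> = 0"
  using assms
proof (induction M arbitrary: c \<alpha> rule: finite_induct)
  case empty
  then show ?case by simp
next
  case (insert \<beta> M)
  define \<mu> :: "(nat \<Rightarrow> nat) \<Rightarrow> (nat \<Rightarrow> 'a) \<Rightarrow> 'a" where "\<mu> \<gamma> x = (\<Prod>i\<le>n. x i ^ \<gamma> i)" for \<gamma> x
  have \<mu>_mult: "\<mu> \<gamma> (\<lambda>i. x i * y i) = \<mu> \<gamma> x * \<mu> \<gamma> y" for \<gamma> x y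
    by (simp add: \<mu>_def power_mult_distrib prod.distrib)
  have rel: "c \<beta> * \<mu> \<beta> x + (\<Sum>\<gamma>\<in>M. c \<gamma> * \<mu> \<gamma> x) = 0" for x
    using insert.prems(2)[of x] insert.hyps by (simp add: \<mu>_def)
  have M0: "c \<gamma> = 0" if "\<gamma> \<in> M" for \<gamma>
  proof -
    have "\<gamma> \<noteq> \<beta>" using that insert.hyps by auto
    then obtain i where i: "\<gamma> i \<noteq> \<beta> i" by auto
    then have "i \<le> n" using insert.prems(1)[of \<gamma> i] insert.prems(1)[of \<beta> i] that by (metis insertCI not_le)
    \<comment> \<open>A single coordinate equal to 2 separates the two characters: their values are
      \<open>2 ^ \<gamma> i\<close> and \<open>2 ^ \<beta> i\<close>, which differ in characteristic
      0.\<close>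
    define y :: "nat \<Rightarrow> 'a" where "y j = (if j = i then 2 else 1)" for j
    have \<mu>y: "\<mu> \<delta> y = 2 ^ \<delta> i" for \<delta>
    proof -
      have "\<mu> \<delta> y = (\<Prod>j\<le>n. if j = i then 2 ^ \<delta> i else 1)"
        unfolding \<mu>_def by (rule prod.cong) (auto simp: y_def)
      then show ?thesis using \<open>i \<le> n\<close> by simp
    qed
    \<comment> \<open>The relation at the product of \<open>x\<close> and \<open>y\<close>, minus
      \<open>\<mu> \<beta> y\<close> times the relation at \<open>x\<close>, no longer contains
      \<open>\<beta>\<close>, so the induction hypothesis applies to it.\<close>
    have "(\<Sum>\<gamma>\<in>M. (c \<gamma> * (\<mu> \<gamma> y - \<mu> \<beta> y)) * (\<Prod>i\<le>n. x i ^ \<gamma> i)) = 0" for x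
    proof -
      have "(\<Sum>\<gamma>\<in>M. (c \<gamma> * (\<mu> \<gamma> y - \<mu> \<beta> y)) * \<mu> \<gamma> x) =
        (\<Sum>\<gamma>\<in>M. c \<gamma> * \<mu> \<gamma> (\<lambda>i. x i * y i)) - \<mu> \<beta> y * (\<Sum>\<gamma>\<in>M. c \<gamma> * \<mu> \<gamma> x)"
        by (simp add: \<mu>_mult sum_distrib_left sum_subtractf[symmetric] algebra_simps)
      also have "\<dots> = - (c \<beta> * \<mu> \<beta> (\<lambda>i. x i * y i)) + \<mu> \<beta> y * (c \<beta> * \<mu> \<beta> x)"
      proof -
        have "(\<Sum>\<gamma>\<in>M. c \<gamma> * \<mu> \<gamma> z) = - (c \<beta> * \<mu> \<beta> z)" for z
          using rel[of z] by (simp add: add_eq_0_iff)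
        then show ?thesis by (simp only: mult_minus_right diff_minus_eq_add)
      qed
      also have "\<dots> = 0" by (simp add: \<mu>_mult algebra_simps)
      finally show ?thesis by (simp add: \<mu>_def)
    qed
    then have "c \<gamma> * (\<mu> \<gamma> y - \<mu> \<beta> y) = 0"
      using insert.IH[of "\<lambda>\<gamma>. c \<gamma> * (\<mu> \<gamma> y - \<mu> \<beta> y)" \<gamma>] insert.prems(1) that by blast
    moreover have "(2::'a) ^ \<gamma> i \<noteq> 2 ^ \<beta> i"
    proof -
      have "(2::nat) ^ \<gamma> i \<noteq> 2 ^ \<beta> i" using i by simp
      then have "(of_nat (2 ^ \<gamma> i) :: 'a) \<noteq> of_nat (2 ^ \<beta> i)" by (simp only: of_nat_eq_iff simp_thms)
      then show ?thesis by simp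
    qed
    ultimately show ?thesis by (simp add: \<mu>y)
  qed
  moreover have "c \<beta> = 0" using rel[of "\<lambda>_. 1"] M0 by (simp add: \<mu>_def)
  ultimately show ?case using insert.prems(3) by blast
qed

lemma pval_nonzero:
  fixes p :: "(nat \<Rightarrow> nat) \<Rightarrow> 'a::field_char_0"
  assumes "\<alpha> \<in> expts n D" "p \<alpha> \<noteq> 0"
  shows "\<exists>x. pval n D p x \<noteq> 0"
proof (rule ccontr)
  assume "\<nexists>x. pval n D p x \<noteq> 0"
  then have "p \<alpha> = 0"
    by (intro monomials_independent[OF finite_expts[of n D] _ _ assms(1)])
       (auto simp: pval_def expts_def)
  then show False using assms(2) by simp
qed

text \<open>The coefficient family of the product of \<open>p\<close> with the variable of index
  \<open>i\<close>. Without the separate case \<open>\<alpha> i = 0\<close>, truncated subtraction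
  would leave \<open>\<alpha>\<close> unchanged and return \<open>p \<alpha>\<close>.\<close>

definition mult_var :: "nat \<Rightarrow> ((nat \<Rightarrow> nat) \<Rightarrow> 'a::zero) \<Rightarrow> (nat \<Rightarrow> nat) \<Rightarrow> 'a" where
  "mult_var i p \<alpha> = (if \<alpha> i = 0 then 0 else p (\<alpha>(i := \<alpha> i - 1)))"

lemma pval_mult_var:
  assumes "i \<le> n"
  shows "pval n (Suc D) (mult_var i p) x = x i * pval n D p x"
proof -
  let ?up = "\<lambda>\<alpha>::nat \<Rightarrow> nat. \<alpha>(i := Suc (\<alpha> i))"
  have sum_up: "(\<Sum>j\<le>n. ?up \<alpha> j) = Suc (\<Sum>j\<le>n. \<alpha> j)" for \<alpha>
    using assms by (simp add: sum.remove[of "{..n}" i])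
  have prod_up: "(\<Prod>j\<le>n. x j ^ ?up \<alpha> j) = x i * (\<Prod>j\<le>n. x j ^ \<alpha> j)" for \<alpha>
    using assms by (simp add: prod.remove[of "{..n}" i])
  have inj: "inj_on ?up (expts n D)"
  proof (rule inj_onI)
    fix \<alpha> \<beta> assume "?up \<alpha> = ?up \<beta>"
    then have "?up \<alpha> j = ?up \<beta> j" for j by simp
    then show "\<alpha> = \<beta>" by (intro ext) (metis fun_upd_apply nat.inject)
  qed
  have im: "?up ` expts n D \<subseteq> expts n (Suc D)"
    using assms by (auto simp: expts_def sum_up simp del: fun_upd_apply) simp
  \<comment> \<open>Exponents outside the image of the shift have \<open>\<alpha> i = 0\<close>,
    since otherwise lowering that entry by one gives a preimage.\<close>
  have zero: "mult_var i p \<alpha> = 0" if "\<alpha> \<in> expts n (Suc D) - ?up ` expts n D" for \<alpha>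
  proof (rule ccontr)
    assume "mult_var i p \<alpha> \<noteq> 0"
    then have "\<alpha> i \<noteq> 0" by (metis mult_var_def)
    define \<beta> where "\<beta> = \<alpha>(i := \<alpha> i - 1)"
    have up: "?up \<beta> = \<alpha>" using \<open>\<alpha> i \<noteq> 0\<close> by (auto simp: \<beta>_def)
    have "(\<Sum>j\<le>n. \<alpha> j) = Suc (\<Sum>j\<le>n. \<beta> j)" using sum_up[of \<beta>] unfolding up .
    then have "\<beta> \<in> expts n D"
      using that by (auto simp: expts_def) (simp add: \<beta>_def)
    then show False using that up by blast
  qed
  have "pval n (Suc D) (mult_var i p) x
      = (\<Sum>\<alpha>\<in>?up ` expts n D. mult_var i p \<alpha> * (\<Prod>i\<le>n. x i ^ \<alpha> i))"
    unfolding pval_def by (rule sum.mono_neutral_right) (use finite_expts im zero in auto)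
  also have "\<dots> = (\<Sum>\<alpha>\<in>expts n D. p \<alpha> * (x i * (\<Prod>i\<le>n. x i ^ \<alpha> i)))"
    unfolding sum.reindex[OF inj] comp_def prod_up
    by (rule sum.cong) (auto simp: mult_var_def)
  finally show ?thesis by (simp add: pval_def sum_distrib_left mult_ac)
qed

section \<open>Limits, compactness and norms in coefficient space\<close>

lemma tendsto_pval:
  fixes p :: "'b \<Rightarrow> (nat \<Rightarrow> nat) \<Rightarrow> 'a::real_normed_field"
  assumes "\<And>\<alpha>. \<alpha> \<in> expts n D \<Longrightarrow> ((\<lambda>k. p k \<alpha>) \<longlongrightarrow> q \<alpha>) F"
    and "\<And>i. i \<le> n \<Longrightarrow> ((\<lambda>k. y k i) \<longlongrightarrow> x i) F"
  shows "((\<lambda>k. pval n D (p k) (y k)) \<longlongrightarrow> pval n D q x) F"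
  unfolding pval_def
  by (intro tendsto_sum tendsto_mult tendsto_prod tendsto_power assms) auto

lemma norm_pval_le:
  fixes p :: "(nat \<Rightarrow> nat) \<Rightarrow> 'a::real_normed_field"
  assumes "\<And>\<alpha>. \<alpha> \<in> expts n D \<Longrightarrow> norm (p \<alpha>) \<le> C"
  shows "norm (pval n D p x) \<le> C * (\<Sum>\<alpha>\<in>expts n D. norm (\<Prod>i\<le>n. x i ^ \<alpha> i))"
  unfolding pval_def sum_distrib_left
  by (rule sum_norm_le) (auto simp: norm_mult assms intro: mult_right_mono)

text \<open>Bolzano-Weierstrass, one coordinate at a time: each new coordinate refines the
  subsequence and keeps the earlier limits.\<close>

lemma finite_coords_convergent_subseq:
  fixes X :: "nat \<Rightarrow> 'b \<Rightarrow> 'a::{real_normed_field,heine_borel}"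
  assumes "finite A" "\<And>k a. a \<in> A \<Longrightarrow> norm (X k a) \<le> C"
  shows "\<exists>r l. strict_mono (r::nat \<Rightarrow> nat) \<and> (\<forall>a\<in>A. (\<lambda>k. X (r k) a) \<longlonglongrightarrow> l a)"
  using assms
proof (induction A rule: finite_induct)
  case empty
  show ?case by (auto intro: strict_mono_id[unfolded id_def])
next
  case (insert b A)
  then obtain r l where r: "strict_mono (r::nat \<Rightarrow> nat)" "\<forall>a\<in>A. (\<lambda>k. X (r k) a) \<longlonglongrightarrow> l a" by auto
  have "bounded (range (\<lambda>k. X (r k) b))"
    using insert.prems by (auto simp: bounded_iff)
  then obtain m s where s: "strict_mono s" "((\<lambda>k. X (r k) b) \<circ> s) \<longlonglongrightarrow> m"
    using bounded_imp_convergent_subsequence by blast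
  have "(\<lambda>k. X (r (s k)) a) \<longlonglongrightarrow> (l(b := m)) a" if "a \<in> insert b A" for a
    using that s r(2) LIMSEQ_subseq_LIMSEQ[of "\<lambda>k. X (r k) a" "l a" s] by (auto simp: comp_def)
  then show ?case using r(1) s(1)
    by (intro exI[of _ "r \<circ> s"] exI[of _ "l(b := m)"]) (simp add: strict_mono_o del: fun_upd_apply o_apply, simp del: fun_upd_apply)
qed

lemma tuples_convergent_subseq:
  fixes X :: "nat \<Rightarrow> 'a::{real_normed_field,heine_borel} tup"
  assumes "\<And>k i \<alpha>. i \<le> n \<Longrightarrow> \<alpha> \<in> expts n D \<Longrightarrow> norm (X k i \<alpha>) \<le> C"
  shows "\<exists>r l. strict_mono (r::nat \<Rightarrow> nat) \<and>
    (\<forall>i \<alpha>. i \<le> n \<longrightarrow> \<alpha> \<in> expts n D \<longrightarrow> (\<lambda>k. X (r k) i \<alpha>) \<longlonglongrightarrow> l i \<alpha>)"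
proof -
  have "\<exists>r l. strict_mono (r::nat \<Rightarrow> nat) \<and>
      (\<forall>a\<in>{..n} \<times> expts n D. (\<lambda>k. (\<lambda>k (i, \<alpha>). X k i \<alpha>) (r k) a) \<longlonglongrightarrow> l a)"
    by (rule finite_coords_convergent_subseq[where C = C]) (use finite_expts assms in auto)
  then obtain r l where "strict_mono (r::nat \<Rightarrow> nat)"
    "\<forall>a\<in>{..n} \<times> expts n D. (\<lambda>k. (\<lambda>k (i, \<alpha>). X k i \<alpha>) (r k) a) \<longlonglongrightarrow> l a" by blast
  then show ?thesis by (intro exI[of _ r] exI[of _ "\<lambda>i \<alpha>. l (i, \<alpha>)"]) auto
qed

text \<open>The l1 norm of the coefficients in the finite range. Other entries are ignored, so on
  the whole function type this is only a seminorm.\<close>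

definition tnorm :: "nat \<Rightarrow> nat \<Rightarrow> 'a::real_normed_field tup \<Rightarrow> real" where
  "tnorm n D h = (\<Sum>i\<le>n. \<Sum>\<alpha>\<in>expts n D. norm (h i \<alpha>))"

lemma norm_le_tnorm:
  assumes "i \<le> n" "\<alpha> \<in> expts n D"
  shows "norm (h i \<alpha>) \<le> tnorm n D h"
proof -
  have "norm (h i \<alpha>) \<le> (\<Sum>\<alpha>\<in>expts n D. norm (h i \<alpha>))"
    using member_le_sum[of \<alpha> "expts n D" "\<lambda>\<alpha>. norm (h i \<alpha>)"] assms finite_expts by auto
  also have "\<dots> \<le> tnorm n D h"
    unfolding tnorm_def
    by (rule member_le_sum[of i "{..n}" "\<lambda>i. \<Sum>\<alpha>\<in>expts n D. norm (h i \<alpha>)"])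
       (use assms in \<open>auto intro: sum_nonneg\<close>)
  finally show ?thesis .
qed

lemma tnorm_nonneg: "0 \<le> tnorm n D h"
  by (auto simp: tnorm_def intro!: sum_nonneg)

lemma tnorm_pos_obtain:
  assumes "tnorm n D h > 0"
  obtains i \<alpha> where "i \<le> n" "\<alpha> \<in> expts n D" "h i \<alpha> \<noteq> 0"
proof -
  have "\<not> (\<forall>i\<le>n. \<forall>\<alpha>\<in>expts n D. h i \<alpha> = 0)"
  proof
    assume "\<forall>i\<le>n. \<forall>\<alpha>\<in>expts n D. h i \<alpha> = 0"
    then have "tnorm n D h = 0" unfolding tnorm_def by (intro sum.neutral) auto
    with assms show False by simp
  qed
  then show ?thesis using that by blast
qed

lemma tnorm_scale: "tnorm n D (\<lambda>i \<alpha>. c * h i \<alpha>) = norm c * tnorm n D h"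
  by (simp add: tnorm_def norm_mult sum_distrib_left)

lemma tendsto_tnorm:
  assumes "\<And>i \<alpha>. i \<le> n \<Longrightarrow> \<alpha> \<in> expts n D \<Longrightarrow> ((\<lambda>k. X k i \<alpha>) \<longlongrightarrow> l i \<alpha>) F"
  shows "((\<lambda>k. tnorm n D (X k)) \<longlongrightarrow> tnorm n D l) F"
  unfolding tnorm_def by (intro tendsto_sum tendsto_norm assms) auto

text \<open>Coefficients of \<open>x\<^sub>0 h\<^sub>i - x\<^sub>i h\<^sub>0\<close>; these forms vanish iff \<open>h\<close> represents the identity.\<close>
definition displ :: "'a::field tup \<Rightarrow> 'a tup" where
  "displ h i \<alpha> = mult_var 0 (h i) \<alpha> - mult_var i (h 0) \<alpha>"

lemma pval_displ:
  assumes "i \<le> n"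
  shows "pval n (Suc D) (displ h i) x = x 0 * pval n D (h i) x - x i * pval n D (h 0) x"
proof -
  have "pval n (Suc D) (displ h i) x
     = pval n (Suc D) (mult_var 0 (h i)) x - pval n (Suc D) (mult_var i (h 0)) x"
    by (simp add: pval_def displ_def left_diff_distrib sum_subtractf)
  then show ?thesis using assms by (simp add: pval_mult_var)
qed

lemma norm_displ_le:
  fixes h :: "'a::real_normed_field tup"
  assumes "\<And>i \<alpha>. norm (h i \<alpha>) \<le> C"
  shows "norm (displ h i \<alpha>) \<le> 2 * C"
proof -
  have "0 \<le> C" using assms[of 0 "\<lambda>_. 0"] norm_ge_zero order_trans by blast
  then have "norm (mult_var j (h l) \<alpha>) \<le> C" for j l
    using assms by (simp add: mult_var_def)
  then show ?thesis unfolding displ_def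
    using norm_triangle_ineq4[of "mult_var 0 (h i) \<alpha>" "mult_var i (h 0) \<alpha>"] by (smt (verit))
qed

lemma tup_eval_eq_pval:
  assumes "birational n d h" "d \<le> D" "i \<le> n"
  shows "tup_eval n d h x i = pval n D (h i) x"
  using peval_eq_pval[of n d h D i x] assms by (simp add: tup_eval_def birational_def)

lemma tnorm_birational_pos:
  assumes "birational n d h" "d \<le> D"
  shows "0 < tnorm n D h"
proof (rule ccontr)
  assume "\<not> 0 < tnorm n D h"
  then have "h i \<alpha> = 0" if "i \<le> n" "\<alpha> \<in> expts n D" for i \<alpha>
    using norm_le_tnorm[OF that, of h] by (simp add: not_less) (metis norm_le_zero_iff order_trans)
  then have "tup_eval n d h x i = 0" if "i \<le> n" for x i
    using that by (simp add: tup_eval_eq_pval[OF assms that] pval_def)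
  then show False using birational_nonzero[OF assms(1)] by (auto simp: nonzero_map_def)
qed

section \<open>Consequences of convergence to the identity\<close>

text \<open>Coefficients are continuous in the product topology, and an evaluation involves only
  finitely many of them.\<close>

lemma tendsto_tup_eval_nhds:
  fixes f :: "'a::real_normed_field tup"
  shows "((\<lambda>f'. tup_eval n d f' x i) \<longlongrightarrow> tup_eval n d f x i) (nhds f)"
proof -
  have c1: "continuous_on UNIV (\<lambda>f'::'a tup. f' i)"
    by (rule continuous_on_product_coordinates)
  have c2: "continuous_on UNIV (\<lambda>p::(nat \<Rightarrow> nat) \<Rightarrow> 'a. p \<alpha>)" for \<alpha>
    by (rule continuous_on_product_coordinates)
  have "continuous_on UNIV (\<lambda>f'::'a tup. f' i \<alpha>)" for \<alpha>
    by (rule continuous_on_compose2[OF c2 c1]) auto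
  then have "open ((\<lambda>f'::'a tup. f' i \<alpha>) -` S)" if "open S" for \<alpha> S
    using that by (intro open_vimage)
  then have "((\<lambda>f'::'a tup. f' i \<alpha>) \<longlongrightarrow> f i \<alpha>) (nhds f)" for \<alpha>
    unfolding tendsto_def eventually_nhds by blast
  then have "((\<lambda>f'. peval n d (f' i) x) \<longlongrightarrow> peval n d (f i) x) (nhds f)"
    unfolding peval_def by (intro tendsto_sum tendsto_mult tendsto_const)
  then show ?thesis by (cases "i \<le> n") (auto simp: tup_eval_def)
qed

text \<open>One nonzero minor at one point witnesses the failure of proportionality. It depends
  jointly continuously on \<open>f'\<close> and on the value of \<open>h k\<close>, so a single
  neighbourhood of \<open>f\<close> serves for all large \<open>k\<close>.\<close>

lemma eventually_not_propto:
  fixes f :: "'a::real_normed_field tup" and H :: "(nat \<Rightarrow> 'a) \<Rightarrow> nat \<Rightarrow> 'a"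
  assumes "\<not> propto n (tup_eval n e f) H"
    and "\<And>x i. i \<le> n \<Longrightarrow> (\<lambda>k. h k x i) \<longlonglongrightarrow> H x i"
  shows "\<exists>T K. open T \<and> f \<in> T \<and>
    (\<forall>f'\<in>T. \<not> propto n (tup_eval n e f') H \<and> (\<forall>k\<ge>K. \<not> propto n (tup_eval n e f') (h k)))"
proof -
  obtain x i j where ij: "i \<le> n" "j \<le> n" and
    nz: "tup_eval n e f x i * H x j - tup_eval n e f x j * H x i \<noteq> 0"
    using assms(1) by (auto simp: propto_def)
  let ?F = "nhds f \<times>\<^sub>F sequentially"
  have t1: "((\<lambda>z. tup_eval n e (fst z) x l) \<longlongrightarrow> tup_eval n e f x l) ?F" for l
    by (rule filterlim_compose[OF tendsto_tup_eval_nhds filterlim_fst])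
  have t2: "((\<lambda>z. h (snd z) x l) \<longlongrightarrow> H x l) ?F" if "l \<le> n" for l
    by (rule filterlim_compose[OF assms(2)[OF that] filterlim_snd])
  have "((\<lambda>z. tup_eval n e (fst z) x i * h (snd z) x j - tup_eval n e (fst z) x j * h (snd z) x i)
      \<longlongrightarrow> tup_eval n e f x i * H x j - tup_eval n e f x j * H x i) ?F"
    by (intro tendsto_diff tendsto_mult t1 t2 ij)
  then have "\<forall>\<^sub>F z in ?F. tup_eval n e (fst z) x i * h (snd z) x j
      - tup_eval n e (fst z) x j * h (snd z) x i \<noteq> 0"
    by (rule tendsto_imp_eventually_ne[OF _ nz])
  then obtain P Q where P: "eventually P (nhds f)" and Q: "eventually Q sequentially"
    and PQ: "\<And>f' k. P f' \<Longrightarrow> Q k \<Longrightarrow> tup_eval n e f' x i * h k x j - tup_eval n e f' x j * h k x i \<noteq> 0"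
    unfolding eventually_prod_filter by auto
  obtain K where K: "\<And>k. k \<ge> K \<Longrightarrow> Q k" using Q by (auto simp: eventually_sequentially)
  have "((\<lambda>f'. tup_eval n e f' x i * H x j - tup_eval n e f' x j * H x i)
      \<longlongrightarrow> tup_eval n e f x i * H x j - tup_eval n e f x j * H x i) (nhds f)"
    by (intro tendsto_diff tendsto_mult tendsto_tup_eval_nhds tendsto_const)
  then have "\<forall>\<^sub>F f' in nhds f. tup_eval n e f' x i * H x j - tup_eval n e f' x j * H x i \<noteq> 0"
    by (rule tendsto_imp_eventually_ne[OF _ nz])
  with P have "\<forall>\<^sub>F f' in nhds f. P f' \<and> tup_eval n e f' x i * H x j - tup_eval n e f' x j * H x i \<noteq> 0"
    by eventually_elim simp
  then obtain T where T: "open T" "f \<in> T"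
    "\<And>f'. f' \<in> T \<Longrightarrow> P f' \<and> tup_eval n e f' x i * H x j - tup_eval n e f' x j * H x i \<noteq> 0"
    unfolding eventually_nhds by blast
  show ?thesis
  proof (intro exI[of _ T] exI[of _ K] conjI T(1,2) ballI allI impI notI)
    fix f' assume "f' \<in> T" "propto n (tup_eval n e f') H"
    then show False using T(3)[of f'] ij by (auto simp: propto_def)
  next
    fix f' k assume "f' \<in> T" "K \<le> k" "propto n (tup_eval n e f') (h k)"
    then show False using T(3)[of f'] PQ[of f' k] K[of k] ij by (auto simp: propto_def)
  qed
qed

text \<open>By \<open>loc\<close>, only the finitely many \<open>b k\<close> with
  \<open>k < K\<close> can occur near a given \<open>f\<close>, and each of these is avoided on some
  neighbourhood of \<open>f\<close>. A finite intersection then does for the whole range.\<close>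

lemma bir_open_remove_range:
  fixes b :: "nat \<Rightarrow> 'a::real_normed_field bir"
  assumes V: "V \<subseteq> Bir n" and b: "\<And>k. b k \<in> Bir n"
    and loc: "\<And>e f. birational n e f \<Longrightarrow> bclass n e f \<in> V \<Longrightarrow> \<exists>T K. open T \<and> f \<in> T \<and>
      (\<forall>f'\<in>T. birational n e f' \<longrightarrow> bclass n e f' \<in> V \<and> (\<forall>k\<ge>K. bclass n e f' \<noteq> b k))"
  shows "bir_open n (V - range b)"
  unfolding bir_open_def
proof (intro conjI allI impI)
  show "V - range b \<subseteq> Bir n" using V by auto
  fix e :: nat
  let ?S = "{h \<in> Hhat n e. bclass n e h \<in> V - range b}"
  show "openin (top_of_set (Hhat n e)) ?S"
  proof (subst openin_subopen, intro ballI)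
    fix f assume f: "f \<in> ?S"
    then have bf: "birational n e f" by (simp add: Hhat_def)
    have "bclass n e f \<in> V" using f by simp
    from loc[OF bf this] obtain T K where T: "open T" "f \<in> T" "\<And>f'. f' \<in> T \<Longrightarrow>
        birational n e f' \<Longrightarrow> bclass n e f' \<in> V \<and> (\<forall>k\<ge>K. bclass n e f' \<noteq> b k)"
      by blast
    have "\<exists>T. open T \<and> f \<in> T \<and> (\<forall>f'\<in>T. birational n e f' \<longrightarrow> bclass n e f' \<noteq> b k)" for k
    proof -
      obtain d h where h: "(d, h) \<in> b k" using Bir_nonempty[OF b] by blast
      note bk = Bir_memD[OF b h]
      have "\<not> propto n (tup_eval n e f) (tup_eval n d h)"
      proof
        assume "propto n (tup_eval n e f) (tup_eval n d h)"
        then have "bclass n e f = b k" using bclass_eq[OF bk(1) bf] bk(2) by simp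
        then show False using f by auto
      qed
      from eventually_not_propto[OF this, of "\<lambda>_. tup_eval n d h"]
      obtain T where "open T" "f \<in> T" "\<And>f'. f' \<in> T \<Longrightarrow> \<not> propto n (tup_eval n e f') (tup_eval n d h)"
        by auto
      moreover have "propto n (tup_eval n e f') (tup_eval n d h)" if "bclass n e f' = b k" for f'
        using h that by (auto simp: bclass_def intro: propto_sym)
      ultimately show ?thesis by blast
    qed
    then obtain S where S: "\<And>k. open (S k)" "\<And>k. f \<in> S k"
      "\<And>k f'. f' \<in> S k \<Longrightarrow> birational n e f' \<Longrightarrow> bclass n e f' \<noteq> b k" by metis
    define W where "W = T \<inter> (\<Inter>k<K. S k)"
    have "open W" unfolding W_def by (intro open_Int open_INT T(1)) (use S(1) in auto)
    moreover have "f \<in> W" using T(2) S(2) by (auto simp: W_def)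
    moreover have "Hhat n e \<inter> W \<subseteq> ?S"
    proof
      fix f' assume f': "f' \<in> Hhat n e \<inter> W"
      then have "birational n e f'" "f' \<in> T" "\<And>k. k < K \<Longrightarrow> f' \<in> S k" by (auto simp: Hhat_def W_def)
      then have "bclass n e f' \<in> V" "bclass n e f' \<noteq> b k" for k
        using T(3)[of f'] S(3)[of f' k] by (auto simp: not_le[symmetric])
      then show "f' \<in> ?S" using f' by auto
    qed
    ultimately show "\<exists>U. openin (top_of_set (Hhat n e)) U \<and> f \<in> U \<and> U \<subseteq> ?S"
      using f by (intro exI[of _ "Hhat n e \<inter> W"]) auto
  qed
qed

text \<open>The indices \<open>\<mu> k\<close> are unbounded, so convergence forces some
  \<open>b k\<close> into the given neighbourhood of the identity, from which the range of
  \<open>b\<close> has been removed.\<close>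

lemma converges_to_id_escape:
  assumes "converges_to_id n G" "bir_open n (V - range b)" "bid n \<in> V - range b"
    and "\<And>k. k \<le> \<mu> k" "\<And>k. b k \<in> G (\<mu> k)"
  shows False
proof -
  obtain m0 where m0: "\<forall>m>m0. G m \<subseteq> V - range b"
    using assms(1,2,3) unfolding converges_to_id_def by blast
  have "m0 < \<mu> (Suc m0)" using assms(4)[of "Suc m0"] by simp
  then show False using m0 assms(5)[of "Suc m0"] by blast
qed

text \<open>Unbounded degrees would give a sequence with only finitely many terms representable in
  each fixed degree. The complement of its range is then an open neighbourhood of the identity that
  it never enters.\<close>

lemma bounded_degree:
  fixes G :: "nat \<Rightarrow> 'a::real_normed_field bir set"
  assumes conv: "converges_to_id n G" and G: "\<And>m. G m \<subseteq> Bir n" and id: "(bid n :: 'a bir) \<in> Bir n"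
  shows "\<exists>D m0. \<forall>m\<ge>m0. \<forall>b\<in>G m. \<exists>d h. (d, h) \<in> b \<and> d \<le> D"
proof (rule ccontr)
  assume "\<not> ?thesis"
  then have neg: "\<forall>D m0. \<exists>m\<ge>m0. \<exists>b\<in>G m. \<forall>d h. (d, h) \<in> b \<longrightarrow> d > D"
    by (meson not_le)
  obtain d0 h0 where h0: "(d0, h0) \<in> (bid n :: 'a bir)" using Bir_nonempty[OF id] by blast
  \<comment> \<open>The offset \<open>d0\<close>, the degree of a representative of the identity,
    keeps the identity out of the sequence.\<close>
  have "\<exists>p. k \<le> fst p \<and> snd p \<in> G (fst p) \<and> (\<forall>d h. (d, h) \<in> snd p \<longrightarrow> d > k + d0)" for k
  proof -
    obtain m b where "k \<le> m" "b \<in> G m" "\<forall>d h. (d, h) \<in> b \<longrightarrow> d > k + d0" using neg by blast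
    then show ?thesis by (intro exI[of _ "(m, b)"]) simp
  qed
  then obtain p where p: "\<And>k. k \<le> fst (p k) \<and> snd (p k) \<in> G (fst (p k)) \<and>
      (\<forall>d h. (d, h) \<in> snd (p k) \<longrightarrow> d > k + d0)" by metis
  define \<mu> b where "\<mu> k = fst (p k)" and "b k = snd (p k)" for k
  have mu: "k \<le> \<mu> k" and b: "b k \<in> G (\<mu> k)" for k using p by (auto simp: \<mu>_def b_def)
  have deg: "d > k + d0" if "(d, h) \<in> b k" for k d h using p that by (auto simp: b_def)
  have "bir_open n (Bir n - range b)"
  proof (rule bir_open_remove_range)
    show "b k \<in> Bir n" for k using b G by blast
    fix e and f :: "'a tup"
    \<comment> \<open>A tuple of degree \<open>e\<close> cannot represent \<open>b k\<close> once
      \<open>e \<le> k\<close>, so the whole space serves as the neighbourhood, with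
      \<open>K = e\<close>.\<close>
    have "bclass n e f' \<in> Bir n \<and> (\<forall>k\<ge>e. bclass n e f' \<noteq> b k)" if "birational n e f'" for f' :: "'a tup"
    proof (intro conjI allI impI notI)
      show "bclass n e f' \<in> Bir n" using that by (auto simp: Bir_def)
      fix k assume "e \<le> k" "bclass n e f' = b k"
      then show False using deg[of e f' k] bclass_refl[OF that] by simp
    qed
    then show "\<exists>T K. open T \<and> f \<in> T \<and>
        (\<forall>f'\<in>T. birational n e f' \<longrightarrow> bclass n e f' \<in> Bir n \<and> (\<forall>k\<ge>K. bclass n e f' \<noteq> b k))"
      by (intro exI[of _ UNIV] exI[of _ e]) auto
  qed simp
  moreover have "bid n \<noteq> b k" for k using deg[of d0 h0 k] h0 by auto
  then have "bid n \<in> Bir n - range b" using id by auto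
  ultimately show False by (rule converges_to_id_escape[OF conv _ _ mu b])
qed

text \<open>The limit \<open>H\<close> need not be birational, so it does not itself define a point of \<open>Bir\<close>.\<close>
lemma limit_propto_id:
  fixes G :: "nat \<Rightarrow> 'a::real_normed_field bir set"
  assumes conv: "converges_to_id n G" and G: "\<And>m. G m \<subseteq> Bir n" and id: "(bid n :: 'a bir) \<in> Bir n"
    and mu: "\<And>k. k \<le> \<mu> k" and h: "\<And>k. birational n (d k) (h k)"
    and hG: "\<And>k. bclass n (d k) (h k) \<in> G (\<mu> k)"
    and lim: "\<And>x i. i \<le> n \<Longrightarrow> (\<lambda>k. tup_eval n (d k) (h k) x i) \<longlonglongrightarrow> H x i"
    and H: "polymap H" "nonzero_map n H"
  shows "propto n H id"
proof (rule ccontr)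
  assume contr: "\<not> propto n H id"
  obtain x i j where ij: "i \<le> n" "j \<le> n" and nz: "H x i * x j - H x j * x i \<noteq> 0"
    using contr by (auto simp: propto_def)
  have "(\<lambda>k. tup_eval n (d k) (h k) x i * x j - tup_eval n (d k) (h k) x j * x i)
      \<longlonglongrightarrow> H x i * x j - H x j * x i"
    by (intro tendsto_intros lim ij)
  then have "\<forall>\<^sub>F k in sequentially. tup_eval n (d k) (h k) x i * x j - tup_eval n (d k) (h k) x j * x i \<noteq> 0"
    by (rule tendsto_imp_eventually_ne[OF _ nz])
  then obtain k0 where k0: "\<And>k. k \<ge> k0 \<Longrightarrow> \<not> propto n (tup_eval n (d k) (h k)) id"
    using ij unfolding eventually_sequentially propto_def by (metis eq_iff_diff_eq_0 id_apply)
  \<comment> \<open>Dropping the first \<open>k0\<close> terms ensures that none of the remaining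
    ones is the identity.\<close>
  define b where "b k = bclass n (d (k + k0)) (h (k + k0))" for k
  \<comment> \<open>This excludes at most the class of \<open>H\<close>, the only place where the
    sequence could accumulate. The identity stays in \<open>V\<close> because \<open>H\<close> is
    assumed not proportional to it.\<close>
  define V where "V = {bclass n e f | e f. birational n e f \<and> \<not> propto n (tup_eval n e f) H}"
  have V_iff: "bclass n e f \<in> V \<longleftrightarrow> \<not> propto n (tup_eval n e f) H" if f: "birational n e f" for e f
  proof
    assume "bclass n e f \<in> V"
    then obtain e' f' where f': "birational n e' f'" "\<not> propto n (tup_eval n e' f') H"
      "bclass n e f = bclass n e' f'" by (auto simp: V_def)
    have "propto n (tup_eval n e' f') (tup_eval n e f)"
      using bclass_refl[OF f'(1)] f'(3) by (auto simp: bclass_def)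
    then show "\<not> propto n (tup_eval n e f) H"
      using propto_trans[OF polymap_tup_eval polymap_tup_eval H(1) _ _ birational_nonzero[OF f]] f'(2)
      by blast
  qed (use f in \<open>auto simp: V_def\<close>)
  have bBir: "b k \<in> Bir n" for k using h by (auto simp: b_def Bir_def)
  have "bir_open n (V - range b)"
  proof (rule bir_open_remove_range)
    show "V \<subseteq> Bir n" by (auto simp: V_def Bir_def)
    fix e and f :: "'a tup"
    assume f: "birational n e f" "bclass n e f \<in> V"
    have "\<not> propto n (tup_eval n e f) H" using V_iff f by blast
    from eventually_not_propto[OF this, of "\<lambda>k. tup_eval n (d (k + k0)) (h (k + k0))",
        OF LIMSEQ_ignore_initial_segment[OF lim]]
    obtain T K where T: "open T" "f \<in> T" "\<And>f'. f' \<in> T \<Longrightarrow> \<not> propto n (tup_eval n e f') H"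
      "\<And>f' k. f' \<in> T \<Longrightarrow> k \<ge> K \<Longrightarrow> \<not> propto n (tup_eval n e f') (tup_eval n (d (k + k0)) (h (k + k0)))"
      by blast
    have "propto n (tup_eval n e f') (tup_eval n (d (k + k0)) (h (k + k0)))"
      if "bclass n e f' = b k" "birational n e f'" for f' k
      using bclass_refl[OF that(2)] that(1) by (auto simp: b_def bclass_def)
    then show "\<exists>T K. open T \<and> f \<in> T \<and>
        (\<forall>f'\<in>T. birational n e f' \<longrightarrow> bclass n e f' \<in> V \<and> (\<forall>k\<ge>K. bclass n e f' \<noteq> b k))"
      using T V_iff by (intro exI[of _ T] exI[of _ K]) blast
  qed (rule bBir)
  moreover have "bid n \<in> V - range b"
  proof -
    obtain e f where "(e, f) \<in> (bid n :: 'a bir)" using Bir_nonempty[OF id] by blast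
    then have f: "birational n e f" "propto n (tup_eval n e f) id" by (auto simp: bid_def)
    have "\<not> propto n (tup_eval n e f) H"
      using propto_trans[OF H(1) polymap_tup_eval polymap_id _ f(2) birational_nonzero[OF f(1)]]
        propto_sym contr by blast
    then have "bid n \<in> V" using V_iff f bclass_eq_bid by metis
    moreover have "bid n \<noteq> b k" for k
    proof
      assume "bid n = b k"
      then have "(d (k + k0), h (k + k0)) \<in> bid n" using bclass_refl[OF h] by (simp add: b_def)
      then show False using k0[of "k + k0"] by (simp add: bid_def)
    qed
    ultimately show ?thesis by auto
  qed
  ultimately show False
    by (rule converges_to_id_escape[OF conv, where \<mu> = "\<lambda>k. \<mu> (k + k0)"])
       (use hG add_leD1[OF mu] in \<open>auto simp: b_def\<close>)
qed

section \<open>Growth of displacements\<close>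

lemma pval_divide: "pval n D (\<lambda>\<alpha>. p \<alpha> / c) x = pval n D p x / c"
  by (simp add: pval_def sum_divide_distrib)

text \<open>If \<open>h\<^sub>k\<close> tends to the identity, then to first order the \<open>K\<close>-th iterate of \<open>h\<^sub>k\<close> moves a generic
  point \<open>K\<close> times as far as \<open>h\<^sub>k\<close> does. Both displacements are rescaled by the same \<open>c\<^sub>k\<close>.\<close>
lemma iterate_displacement:
  fixes h h' :: "nat \<Rightarrow> 'a::real_normed_field tup"
  assumes h: "\<And>k. birational n (d k) (h k)" "\<And>k. d k \<le> D"
    and h': "\<And>k. birational n (d' k) (h' k)" "\<And>k. d' k \<le> D"
    and iter: "\<And>k. propto n (tup_eval n (d' k) (h' k)) (tup_eval n (d k) (h k) ^^ K)"
    and lim_h: "\<And>i \<alpha>. i \<le> n \<Longrightarrow> \<alpha> \<in> expts n D \<Longrightarrow> (\<lambda>k. h k i \<alpha>) \<longlonglongrightarrow> l i \<alpha>"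
    and lim_h': "\<And>i \<alpha>. i \<le> n \<Longrightarrow> \<alpha> \<in> expts n D \<Longrightarrow> (\<lambda>k. h' k i \<alpha>) \<longlonglongrightarrow> l' i \<alpha>"
    and lim_q: "\<And>i \<alpha>. i \<le> n \<Longrightarrow> \<alpha> \<in> expts n (Suc D) \<Longrightarrow> (\<lambda>k. displ (h k) i \<alpha> / c k) \<longlonglongrightarrow> q i \<alpha>"
    and lim_q': "\<And>i \<alpha>. i \<le> n \<Longrightarrow> \<alpha> \<in> expts n (Suc D) \<Longrightarrow> (\<lambda>k. displ (h' k) i \<alpha> / c k) \<longlonglongrightarrow> q' i \<alpha>"
    and id: "\<And>i. i \<le> n \<Longrightarrow> pval n D (l i) x * x 0 = pval n D (l 0) x * x i"
    and nz: "x 0 \<noteq> 0" "pval n D (l 0) x \<noteq> 0" and i: "i \<le> n"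
  shows "pval n D (l 0) x * pval n (Suc D) (q' i) x
    = of_nat K * pval n D (l' 0) x * pval n (Suc D) (q i) x"
proof -
  define E where "E k = tup_eval n (d k) (h k)" for k
  have E: "E k z i = pval n D (h k i) z" if "i \<le> n" for k z i
    unfolding E_def by (rule tup_eval_eq_pval[OF h that])
  \<comment> \<open>The orbit of \<open>x\<close>, rescaled at each step to bring coordinate 0 back
    to \<open>x 0\<close>. Division by zero returns 0, so this normalisation holds only for all
    large \<open>k\<close>.\<close>
  define y where "y k j = ((\<lambda>z i. E k z i * x 0 / E k z 0) ^^ j) x" for k j
  have y_0: "y k 0 = x" and y_Suc: "y k (Suc j) i = E k (y k j) i * x 0 / E k (y k j) 0" for k j i
    by (simp_all add: y_def)
  have y_lim: "(\<lambda>k. y k j i) \<longlonglongrightarrow> x i" if "i \<le> n" for i j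
    using that
  proof (induction j arbitrary: i)
    case (Suc j)
    have "(\<lambda>k. pval n D (h k l') (y k j)) \<longlonglongrightarrow> pval n D (l l') x" if "l' \<le> n" for l'
      by (rule tendsto_pval) (use lim_h that Suc.IH in auto)
    then have "(\<lambda>k. pval n D (h k i) (y k j) * x 0 / pval n D (h k 0) (y k j))
        \<longlonglongrightarrow> pval n D (l i) x * x 0 / pval n D (l 0) x"
      using Suc.prems nz by (intro tendsto_divide tendsto_mult tendsto_const) auto
    then show ?case using Suc.prems id[OF Suc.prems] nz by (simp add: y_Suc E)
  qed (simp add: y_0)
  have E_lim: "(\<lambda>k. E k (y k j) 0) \<longlonglongrightarrow> pval n D (l 0) x" for j
    unfolding E[OF le0] by (rule tendsto_pval) (use lim_h y_lim in auto)
  have E_nz: "\<forall>\<^sub>F k in sequentially. E k (y k j) 0 \<noteq> 0" for j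
    by (rule tendsto_imp_eventually_ne[OF E_lim nz(2)])
  have y_first: "\<forall>\<^sub>F k in sequentially. y k j 0 = x 0" for j
  proof (cases j)
    case (Suc j')
    from E_nz[of j'] show ?thesis by eventually_elim (simp add: Suc y_Suc)
  qed (simp add: y_0)
  \<comment> \<open>One step moves coordinate \<open>i\<close> by the displacement form divided by
    \<open>E k (y k j) 0\<close>. After division by \<open>c k\<close> this has the same limit at
    every step, because the orbit points tend to \<open>x\<close>; adding up the steps gives the
    factor \<open>j\<close>.\<close>
  have disp: "(\<lambda>k. (y k j i - x i) / c k) \<longlonglongrightarrow> of_nat j * (pval n (Suc D) (q i) x / pval n D (l 0) x)" for j
  proof (induction j)
    case (Suc j)
    have "(\<lambda>k. pval n (Suc D) (\<lambda>\<alpha>. displ (h k) i \<alpha> / c k) (y k j)) \<longlonglongrightarrow> pval n (Suc D) (q i) x"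
      by (rule tendsto_pval) (use lim_q i y_lim in auto)
    then have "(\<lambda>k. (y k j i - x i) / c k
          + pval n (Suc D) (\<lambda>\<alpha>. displ (h k) i \<alpha> / c k) (y k j) / E k (y k j) 0)
        \<longlonglongrightarrow> of_nat j * (pval n (Suc D) (q i) x / pval n D (l 0) x)
            + pval n (Suc D) (q i) x / pval n D (l 0) x"
      by (intro tendsto_add Suc tendsto_divide E_lim nz)
    moreover have "\<forall>\<^sub>F k in sequentially. (y k j i - x i) / c k
          + pval n (Suc D) (\<lambda>\<alpha>. displ (h k) i \<alpha> / c k) (y k j) / E k (y k j) 0
        = (y k (Suc j) i - x i) / c k"
      using E_nz[of j] y_first[of j]
    proof eventually_elim
      case (elim k)
      have "pval n (Suc D) (displ (h k) i) (y k j) / E k (y k j) 0 = y k (Suc j) i - y k j i"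
        using elim i by (simp add: pval_displ y_Suc E[symmetric] field_simps)
      moreover have "pval n (Suc D) (\<lambda>\<alpha>. displ (h k) i \<alpha> / c k) (y k j) / E k (y k j) 0
          = (pval n (Suc D) (displ (h k) i) (y k j) / E k (y k j) 0) / c k"
        by (simp add: pval_divide mult.commute)
      ultimately show ?case by (simp add: diff_divide_distrib)
    qed
    ultimately have "(\<lambda>k. (y k (Suc j) i - x i) / c k)
        \<longlonglongrightarrow> of_nat j * (pval n (Suc D) (q i) x / pval n D (l 0) x)
            + pval n (Suc D) (q i) x / pval n D (l 0) x"
      by (rule Lim_transform_eventually)
    then show ?case by (simp add: distrib_right add_divide_distrib add.commute)
  qed (simp add: y_0)
  \<comment> \<open>Rescaling the orbit is harmless: by homogeneity the true iterate remains a
    nonzero multiple of \<open>y k J\<close> as long as no denominator vanishes.\<close>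
  have scal: "\<exists>a. a \<noteq> 0 \<and> (\<forall>i\<le>n. (E k ^^ J) x i = a * y k J i)"
    if "\<forall>j<J. E k (y k j) 0 \<noteq> 0" for k J
    using that
  proof (induction J)
    case 0
    show ?case by (rule exI[of _ 1]) (simp add: y_0)
  next
    case (Suc J)
    then obtain a where a: "a \<noteq> 0" "\<forall>i\<le>n. (E k ^^ J) x i = a * y k J i" by auto
    have "(E k ^^ Suc J) x i = a ^ d k * (E k (y k J) 0 / x 0) * y k (Suc J) i" for i
      using tup_eval_homogeneous[of n "(E k ^^ J) x" a "y k J" "d k" "h k" i] a(2) nz Suc.prems
      by (simp add: y_Suc E_def)
    then show ?case using a(1) Suc.prems nz
      by (intro exI[of _ "a ^ d k * (E k (y k J) 0 / x 0)"]) auto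
  qed
  have "\<forall>\<^sub>F k in sequentially. \<forall>j\<in>{..<K}. E k (y k j) 0 \<noteq> 0"
    by (intro eventually_ball_finite ballI E_nz) auto
  \<comment> \<open>Since \<open>h' k\<close> is proportional to the \<open>K\<close>-th iterate,
    its displacement form at \<open>x\<close> equals its coordinate 0 times the displacement of the
    orbit point.\<close>
  then have ev: "\<forall>\<^sub>F k in sequentially. pval n (Suc D) (\<lambda>\<alpha>. displ (h' k) i \<alpha> / c k) x
      = pval n D (h' k 0) x * ((y k K i - x i) / c k)"
    using y_first[of K]
  proof eventually_elim
    case (elim k)
    then obtain a where a: "a \<noteq> 0" "\<forall>i\<le>n. (E k ^^ K) x i = a * y k K i"
      using scal[where k = k and J = K] by auto
    have "pval n D (h' k i) x * (E k ^^ K) x 0 = pval n D (h' k 0) x * (E k ^^ K) x i"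
      using iter[of k] i unfolding propto_def E_def
      by (simp add: tup_eval_eq_pval[OF h'(1,2)])
    then have "pval n D (h' k i) x * x 0 = pval n D (h' k 0) x * y k K i"
      using a i elim by simp
    then have "x 0 * pval n D (h' k i) x - x i * pval n D (h' k 0) x = pval n D (h' k 0) x * (y k K i - x i)"
      by (simp add: algebra_simps)
    then show ?case using i by (simp add: pval_divide pval_displ)
  qed
  have "(\<lambda>k. pval n (Suc D) (\<lambda>\<alpha>. displ (h' k) i \<alpha> / c k) x) \<longlonglongrightarrow> pval n (Suc D) (q' i) x"
    by (intro tendsto_pval tendsto_const lim_q' i)
  from Lim_transform_eventually[OF this ev]
  have "(\<lambda>k. pval n D (h' k 0) x * ((y k K i - x i) / c k)) \<longlonglongrightarrow> pval n (Suc D) (q' i) x" .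
  moreover have "(\<lambda>k. pval n D (h' k 0) x * ((y k K i - x i) / c k))
      \<longlonglongrightarrow> pval n D (l' 0) x * (of_nat K * (pval n (Suc D) (q i) x / pval n D (l 0) x))"
    by (intro tendsto_mult disp tendsto_pval tendsto_const lim_h') auto
  ultimately have "pval n (Suc D) (q' i) x
      = pval n D (l' 0) x * (of_nat K * (pval n (Suc D) (q i) x / pval n D (l 0) x))"
    by (rule LIMSEQ_unique)
  then show ?thesis using nz by simp
qed

section \<open>Near-maximal elements and limits of normalised representatives\<close>

lemma near_maximal_positive:
  fixes S :: "real set"
  assumes "bdd_above S" "s \<in> S" "0 < s"
  shows "\<exists>t\<in>S. 0 < t \<and> (\<forall>u\<in>S. u \<le> 2 * t)"
proof -
  have le: "u \<le> Sup S" if "u \<in> S" for u using cSup_upper[OF that assms(1)] .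
  \<comment> \<open>The supremum may fail to be attained, so half of it serves as the threshold;
    positivity makes this strictly smaller.\<close>
  then have "Sup S / 2 < Sup S" using assms(2,3) by force
  then obtain t where t: "t \<in> S" "Sup S / 2 < t"
    using less_cSup_iff[OF _ assms(1)] assms(2) by blast
  then show ?thesis using le assms(2,3) by (intro bexI[of _ t]) force+
qed

text \<open>If \<open>l 0\<close> vanished identically, every \<open>l i\<close> would vanish off
  the hyperplane where coordinate 0 is zero, hence everywhere, and all its coefficients would be
  zero.\<close>

lemma propto_id_first_coord_nonzero:
  fixes l :: "'a::real_normed_field tup"
  assumes "\<And>x i. i \<le> n \<Longrightarrow> pval n D (l i) x * x 0 = pval n D (l 0) x * x i" "0 < tnorm n D l"
  shows "\<exists>x. pval n D (l 0) x \<noteq> 0"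
proof -
  obtain i \<alpha> where i: "i \<le> n" "\<alpha> \<in> expts n D" "l i \<alpha> \<noteq> 0" using tnorm_pos_obtain[OF assms(2)] .
  obtain y where "pval n D (l i) y \<noteq> 0" using pval_nonzero[of \<alpha> n D "l i"] i by blast
  from polyfun_common_nonzero[OF polyfun_pval polyfun.coord[of 0] this, of "\<lambda>_. 1"]
  obtain z where "pval n D (l i) z \<noteq> 0" "z 0 \<noteq> 0" by auto
  then show ?thesis using assms(1)[OF i(1), of z] by (intro exI[of _ z]) auto
qed

text \<open>Unit norm passes to the limit, so some limit coefficient is nonzero and the limit is a
  nonzero polynomial map, as \<open>limit_propto_id\<close> requires.\<close>

lemma limit_coeffs_propto_id:
  fixes G :: "nat \<Rightarrow> 'a::real_normed_field bir set"
  assumes conv: "converges_to_id n G" and G: "\<And>m. G m \<subseteq> Bir n" and id: "(bid n :: 'a bir) \<in> Bir n"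
    and mu: "\<And>k. k \<le> \<mu> k" and h: "\<And>k. birational n (d k) (h k)" "\<And>k. d k \<le> D"
    and hG: "\<And>k. bclass n (d k) (h k) \<in> G (\<mu> k)"
    and nrm: "\<And>k. tnorm n D (h k) = 1"
    and lim: "\<And>i \<alpha>. i \<le> n \<Longrightarrow> \<alpha> \<in> expts n D \<Longrightarrow> (\<lambda>k. h k i \<alpha>) \<longlonglongrightarrow> l i \<alpha>"
  shows "tnorm n D l = 1"
    and "\<And>x i. i \<le> n \<Longrightarrow> pval n D (l i) x * x 0 = pval n D (l 0) x * x i"
proof -
  show l1: "tnorm n D l = 1"
    using tendsto_tnorm[of n D h l sequentially, OF lim] by (simp add: nrm LIMSEQ_const_iff)
  define H where "H x i = (if i \<le> n then pval n D (l i) x else 0)" for x i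
  have "(\<lambda>x. H x i) \<in> polyfun" for i
    using polyfun_pval[of n D "l i"] by (cases "i \<le> n") (simp_all add: H_def polyfun.const)
  then have pm: "polymap H" by (simp add: polymap_def)
  obtain i \<alpha> where i: "i \<le> n" "\<alpha> \<in> expts n D" "l i \<alpha> \<noteq> 0"
    using tnorm_pos_obtain[of n D l] l1 by auto
  then have "nonzero_map n H"
    using pval_nonzero[of \<alpha> n D "l i"] by (auto simp: nonzero_map_def H_def)
  moreover have "(\<lambda>k. tup_eval n (d k) (h k) x i) \<longlonglongrightarrow> H x i" if "i \<le> n" for x i
    using that by (simp add: tup_eval_eq_pval[OF h that] H_def) (intro tendsto_pval lim tendsto_const)
  ultimately have "propto n H id"
    using limit_propto_id[OF conv G id mu h(1) hG _ pm] by blast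
  then show "pval n D (l i) x * x 0 = pval n D (l 0) x * x i" if "i \<le> n" for x i
    using that by (simp add: propto_def H_def)
qed

lemma coeff_norm_le_tnorm:
  assumes "birational n d h" "d \<le> D"
  shows "norm (h i \<alpha>) \<le> tnorm n D h"
proof (cases "i \<le> n \<and> \<alpha> \<in> expts n D")
  case True
  then show ?thesis using norm_le_tnorm by blast
next
  case False
  then have "n < i \<or> \<alpha> \<notin> mons n d" using assms(2) by (auto simp: expts_def mons_def)
  then show ?thesis
    using assms(1) tnorm_nonneg[of n D h] by (auto simp: birational_def coeff_tup_def)
qed

text \<open>The displacement forms are only the minors involving index 0. Where coordinate 0 is
  nonzero the remaining minors vanish as well, and a generic point suffices.\<close>

lemma propto_id_if_displ_zero:
  fixes h :: "'a::real_normed_field tup"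
  assumes h: "birational n d h" "d \<le> D" and zero: "tnorm n (Suc D) (displ h) = 0"
  shows "propto n (tup_eval n d h) id"
proof -
  let ?E = "tup_eval n d h"
  have "displ h i \<alpha> = 0" if "i \<le> n" "\<alpha> \<in> expts n (Suc D)" for i \<alpha>
    using norm_le_tnorm[OF that, of "displ h"] zero by simp
  then have "pval n (Suc D) (displ h i) x = 0" if "i \<le> n" for i x
    using that by (simp add: pval_def)
  then have E0: "x 0 * ?E x i = x i * ?E x 0" if "i \<le> n" for i x
    using that pval_displ[OF that, of D h x] by (simp add: tup_eval_eq_pval[OF h])
  have "?E x i * x j - ?E x j * x i = 0" if "i \<le> n" "j \<le> n" for x i j
  proof (rule ccontr)
    assume nz: "?E x i * x j - ?E x j * x i \<noteq> 0"
    have "(\<lambda>x. ?E x i * x j - ?E x j * x i) \<in> polyfun"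
      using polymap_tup_eval[of n d h] unfolding polymap_def
      by (intro polyfun_diff polyfun.mult polyfun.coord) blast+
    from polyfun_common_nonzero[OF this polyfun.coord[of 0] nz, of "\<lambda>_. 1"]
    obtain z where z: "?E z i * z j - ?E z j * z i \<noteq> 0" "z 0 \<noteq> 0" by auto
    have "z 0 * (?E z i * z j - ?E z j * z i) = (z 0 * ?E z i) * z j - (z 0 * ?E z j) * z i"
      by (simp add: right_diff_distrib mult.assoc)
    also have "\<dots> = 0" unfolding E0[OF that(1)] E0[OF that(2)] by (simp add: mult_ac)
    finally show False using z by simp
  qed
  then show ?thesis by (simp add: propto_def)
qed

section \<open>Powers of elements with near-maximal displacement\<close>

lemma bpow_closed:
  assumes "subgroup H (BirG n)" "b \<in> H"
  shows "bpow n b k \<in> H"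
  using subgroup.one_closed[OF assms(1)] subgroup.m_closed[OF assms(1) assms(2)]
  by (induction k) (auto simp: BirG_def)

text \<open>The class constraints cover the real and the complex field at once;
  \<open>heine_borel\<close> supplies convergent subsequences of bounded coefficients.\<close>

theorem subgroups_converging_to_id_trivial:
  fixes G :: "nat \<Rightarrow> 'a::{real_normed_field,heine_borel} bir set"
  assumes sub: "\<And>m. subgroup (G m) (BirG n)" and conv: "converges_to_id n G"
  shows "\<exists>m0. \<forall>m\<ge>m0. G m = {bid n}"
proof (rule ccontr)
  assume neg: "\<not> ?thesis"
  have G: "G m \<subseteq> Bir n" for m using subgroup.subset[OF sub[of m]] by (simp add: BirG_def)
  have id_G: "bid n \<in> G m" for m using subgroup.one_closed[OF sub[of m]] by (simp add: BirG_def)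
  have id: "(bid n :: 'a bir) \<in> Bir n" using id_G G by blast
  obtain D m0 where deg: "\<And>m b. m \<ge> m0 \<Longrightarrow> b \<in> G m \<Longrightarrow> \<exists>d h. (d, h) \<in> b \<and> d \<le> D"
    using bounded_degree[OF conv G id] by blast
  \<comment> \<open>Unit norm and a common degree bound keep all these representatives in a bounded
    set and their limits away from zero.\<close>
  define R where "R m = {(d, h). birational n d h \<and> d \<le> D \<and> bclass n d h \<in> G m \<and> tnorm n D h = 1}" for m
  define \<delta> where "\<delta> h = tnorm n (Suc D) (displ h)" for h :: "'a tup"
  have R_rep: "\<exists>d h. (d, h) \<in> R m \<and> b = bclass n d h" if mb: "m \<ge> m0" "b \<in> G m" for m b
  proof -
    obtain d h where h: "(d, h) \<in> b" "d \<le> D" using deg[OF mb] by blast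
    note bh = Bir_memD[OF subsetD[OF G mb(2)] h(1)]
    define c :: 'a where "c = of_real (inverse (tnorm n D h))"
    have pos: "0 < tnorm n D h" by (rule tnorm_birational_pos[OF bh(1) h(2)])
    then have "c \<noteq> 0" by (simp add: c_def)
    note sc = birational_scale[OF bh(1) this]
    have "tnorm n D (\<lambda>i \<alpha>. c * h i \<alpha>) = 1" using pos by (simp add: tnorm_scale c_def norm_inverse)
    then show ?thesis
      using sc bh(2) h(2) mb(2) by (intro exI[of _ d] exI[of _ "\<lambda>i \<alpha>. c * h i \<alpha>"]) (simp add: R_def)
  qed
  have R_bound: "norm (h i \<alpha>) \<le> 1" if "(d, h) \<in> R m" for d h m i \<alpha>
    using that coeff_norm_le_tnorm[of n d h D i \<alpha>] by (auto simp: R_def)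
  have \<delta>_bound: "\<delta> h \<le> (\<Sum>i\<le>n. \<Sum>\<alpha>\<in>expts n (Suc D). 2)" if "(d, h) \<in> R m" for d h m
    unfolding \<delta>_def tnorm_def
    using norm_displ_le[of h 1, OF R_bound[OF that]] by (intro sum_mono) auto
  \<comment> \<open>The chosen \<open>h\<close> is compared with all normalised representatives of
    elements of \<open>G m\<close>, in particular with those of its own powers.\<close>
  have "\<exists>m d h. k \<le> m \<and> m0 \<le> m \<and> (d, h) \<in> R m \<and> 0 < \<delta> h \<and> (\<forall>(d', h')\<in>R m. \<delta> h' \<le> 2 * \<delta> h)" for k
  proof -
    obtain m where m: "m \<ge> max k m0" "G m \<noteq> {bid n}" using neg by blast
    then obtain b where b: "b \<in> G m" "b \<noteq> bid n" using id_G[of m] by blast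
    have "m0 \<le> m" using m by simp
    obtain d h where h: "(d, h) \<in> R m" "b = bclass n d h" using R_rep[OF \<open>m0 \<le> m\<close> b(1)] by blast
    then have bh: "birational n d h" "d \<le> D" by (auto simp: R_def)
    have "\<delta> h \<noteq> 0"
      using propto_id_if_displ_zero[OF bh] bclass_eq_bid[OF bh(1)] h(2) b(2) by (auto simp: \<delta>_def)
    then have "0 < \<delta> h" using tnorm_nonneg[of n "Suc D" "displ h"] by (simp add: \<delta>_def)
    moreover have "bdd_above ((\<lambda>(d, h). \<delta> h) ` R m)"
      using \<delta>_bound by (intro bdd_aboveI[of _ "\<Sum>i\<le>n. \<Sum>\<alpha>\<in>expts n (Suc D). 2"]) auto
    moreover have "\<delta> h \<in> (\<lambda>(d, h). \<delta> h) ` R m" using h(1) by force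
    ultimately obtain t where t: "t \<in> (\<lambda>(d, h). \<delta> h) ` R m" "0 < t" "\<forall>u\<in>(\<lambda>(d, h). \<delta> h) ` R m. u \<le> 2 * t"
      using near_maximal_positive by blast
    then obtain d1 h1 where "(d1, h1) \<in> R m" "t = \<delta> h1" by auto
    then show ?thesis using t m(1)
      by (intro exI[of _ m] exI[of _ d1] exI[of _ h1]) auto
  qed
  then obtain \<mu>0 d0 h0 where seq0: "\<And>k. k \<le> \<mu>0 k" "\<And>k. m0 \<le> \<mu>0 k" "\<And>k. (d0 k, h0 k) \<in> R (\<mu>0 k)"
    "\<And>k. 0 < \<delta> (h0 k)" "\<And>k. \<forall>(d', h')\<in>R (\<mu>0 k). \<delta> h' \<le> 2 * \<delta> (h0 k)"
    by metis
  obtain r1 l where r1: "strict_mono r1"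
    "\<And>i \<alpha>. i \<le> n \<Longrightarrow> \<alpha> \<in> expts n D \<Longrightarrow> (\<lambda>k. h0 (r1 k) i \<alpha>) \<longlonglongrightarrow> l i \<alpha>"
    using tuples_convergent_subseq[of n D h0 1, OF R_bound[OF seq0(3)]] by blast
  \<comment> \<open>The scale is the displacement norm itself, embedded in the field, so that the
    rescaled forms have norm one and a nonzero limit.\<close>
  define c0 :: "nat \<Rightarrow> 'a" where "c0 k = of_real (\<delta> (h0 k))" for k
  have q_bound: "norm (displ (h0 (r1 k)) i \<alpha> / c0 (r1 k)) \<le> 1" if "i \<le> n" "\<alpha> \<in> expts n (Suc D)" for k i \<alpha>
    using norm_le_tnorm[OF that, of "displ (h0 (r1 k))"] seq0(4)[of "r1 k"]
    by (simp add: c0_def \<delta>_def norm_divide)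
  obtain r2 q where r2: "strict_mono r2" "\<And>i \<alpha>. i \<le> n \<Longrightarrow> \<alpha> \<in> expts n (Suc D) \<Longrightarrow>
      (\<lambda>k. displ (h0 (r1 (r2 k))) i \<alpha> / c0 (r1 (r2 k))) \<longlonglongrightarrow> q i \<alpha>"
    using tuples_convergent_subseq[of n "Suc D" "\<lambda>k i \<alpha>. displ (h0 (r1 k)) i \<alpha> / c0 (r1 k)" 1, OF q_bound]
    by blast
  define r where "r k = r1 (r2 k)" for k
  have r_mono: "strict_mono r" using strict_mono_o[OF r1(1) r2(1)] by (simp add: r_def[abs_def] comp_def)
  define \<mu> d h c where "\<mu> k = \<mu>0 (r k)" and "d k = d0 (r k)" and "h k = h0 (r k)" and "c k = c0 (r k)" for k
  have mu: "k \<le> \<mu> k" for k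
    using seq_suble[OF r_mono, of k] seq0(1)[of "r k"] by (simp add: \<mu>_def)
  have mu0: "m0 \<le> \<mu> k" for k using seq0(2) by (simp add: \<mu>_def)
  have hR: "(d k, h k) \<in> R (\<mu> k)" for k using seq0(3) by (simp add: \<mu>_def d_def h_def)
  then have h: "birational n (d k) (h k)" "d k \<le> D" "bclass n (d k) (h k) \<in> G (\<mu> k)" "tnorm n D (h k) = 1" for k
    by (auto simp: R_def)
  have c: "c k = of_real (\<delta> (h k))" "0 < \<delta> (h k)" for k using seq0(4) by (simp_all add: c_def c0_def h_def)
  have max: "\<delta> h' \<le> 2 * \<delta> (h k)" if "(d', h') \<in> R (\<mu> k)" for d' h' k
    using seq0(5)[of "r k"] that by (auto simp: \<mu>_def h_def)
  have lim_h: "(\<lambda>k. h k i \<alpha>) \<longlonglongrightarrow> l i \<alpha>" if "i \<le> n" "\<alpha> \<in> expts n D" for i \<alpha>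
    using LIMSEQ_subseq_LIMSEQ[OF r1(2)[OF that] r2(1)] by (simp add: h_def r_def comp_def)
  have lim_q: "(\<lambda>k. displ (h k) i \<alpha> / c k) \<longlonglongrightarrow> q i \<alpha>" if "i \<le> n" "\<alpha> \<in> expts n (Suc D)" for i \<alpha>
    using r2(2)[OF that] by (simp add: h_def c_def r_def)
  have l1: "tnorm n D l = 1"
    by (rule limit_coeffs_propto_id(1)[OF conv G id mu h lim_h])
  have l_id: "pval n D (l i) x * x 0 = pval n D (l 0) x * x i" if "i \<le> n" for i x
    by (rule limit_coeffs_propto_id(2)[OF conv G id mu h lim_h that])
  \<comment> \<open>\<open>A\<close> and \<open>Q\<close> are limits for the exponent
    \<open>K\<close>, along a subsequence that may depend on \<open>K\<close>; \<open>l\<close>,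
    \<open>q\<close> and the bound 2 are the same for every \<open>K\<close>.\<close>
  define good where "good K A Q \<longleftrightarrow> tnorm n D A = 1 \<and> (\<forall>i x. i \<le> n \<longrightarrow> pval n D (A i) x * x 0 = pval n D (A 0) x * x i) \<and>
      (\<forall>i \<alpha>. i \<le> n \<longrightarrow> \<alpha> \<in> expts n (Suc D) \<longrightarrow> norm (Q i \<alpha>) \<le> 2) \<and>
      (\<forall>x i. i \<le> n \<longrightarrow> x 0 \<noteq> 0 \<longrightarrow> pval n D (l 0) x \<noteq> 0 \<longrightarrow> pval n D (l 0) x * pval n (Suc D) (Q i) x
          = of_nat K * pval n D (A 0) x * pval n (Suc D) (q i) x)" for K and A Q :: "'a tup"
  have "\<exists>A Q. good K A Q" for K
  proof -
    have pw: "bpow n (bclass n (d k) (h k)) j \<in> G (\<mu> k)" for k j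
      by (rule bpow_closed[OF sub h(3)])
    \<comment> \<open>Powers stay in the subgroup, so their normalised representatives obey the
      near-maximality bound.\<close>
    have "\<forall>k. \<exists>d' h'. (d', h') \<in> R (\<mu> k) \<and> bpow n (bclass n (d k) (h k)) K = bclass n d' h'"
      using R_rep[OF mu0 pw] by blast
    then obtain d' h' where h'R: "\<And>k. (d' k, h' k) \<in> R (\<mu> k)"
      and pow: "\<And>k. bpow n (bclass n (d k) (h k)) K = bclass n (d' k) (h' k)" by metis
    have h': "birational n (d' k) (h' k)" "d' k \<le> D" "bclass n (d' k) (h' k) \<in> G (\<mu> k)" "tnorm n D (h' k) = 1" for k
      using h'R by (auto simp: R_def)
    have iter: "propto n (tup_eval n (d' k) (h' k)) (tup_eval n (d k) (h k) ^^ K)" for k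
      using pow[of k] bclass_refl[OF h'(1)[of k]] subsetD[OF G pw]
      by (intro bpow_rep[OF h(1)]) auto
    have Q_bound: "norm (displ (h' k) i \<alpha> / c k) \<le> 2" if "i \<le> n" "\<alpha> \<in> expts n (Suc D)" for k i \<alpha>
    proof -
      have "norm (displ (h' k) i \<alpha>) \<le> 2 * \<delta> (h k)"
        using norm_le_tnorm[OF that, of "displ (h' k)"] max[OF h'R[of k]] by (simp add: \<delta>_def)
      then show ?thesis using c[of k] by (simp add: norm_divide field_simps)
    qed
    obtain s1 A where s1: "strict_mono s1"
      "\<And>i \<alpha>. i \<le> n \<Longrightarrow> \<alpha> \<in> expts n D \<Longrightarrow> (\<lambda>k. h' (s1 k) i \<alpha>) \<longlonglongrightarrow> A i \<alpha>"
      using tuples_convergent_subseq[of n D h' 1, OF R_bound[OF h'R]] by blast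
    obtain s2 Q where s2: "strict_mono s2" "\<And>i \<alpha>. i \<le> n \<Longrightarrow> \<alpha> \<in> expts n (Suc D) \<Longrightarrow>
        (\<lambda>k. displ (h' (s1 (s2 k))) i \<alpha> / c (s1 (s2 k))) \<longlonglongrightarrow> Q i \<alpha>"
      using tuples_convergent_subseq[of n "Suc D" "\<lambda>k i \<alpha>. displ (h' (s1 k)) i \<alpha> / c (s1 k)" 2, OF Q_bound]
      by blast
    define s where "s k = s1 (s2 k)" for k
    have s_mono: "strict_mono s" using strict_mono_o[OF s1(1) s2(1)] by (simp add: s_def[abs_def] comp_def)
    have lim_A: "(\<lambda>k. h' (s k) i \<alpha>) \<longlonglongrightarrow> A i \<alpha>" if "i \<le> n" "\<alpha> \<in> expts n D" for i \<alpha>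
      using LIMSEQ_subseq_LIMSEQ[OF s1(2)[OF that] s2(1)] by (simp add: s_def comp_def)
    have lim_Q: "(\<lambda>k. displ (h' (s k)) i \<alpha> / c (s k)) \<longlonglongrightarrow> Q i \<alpha>" if "i \<le> n" "\<alpha> \<in> expts n (Suc D)" for i \<alpha>
      using s2(2)[OF that] by (simp add: s_def)
    have lim_hs: "(\<lambda>k. h (s k) i \<alpha>) \<longlonglongrightarrow> l i \<alpha>" if "i \<le> n" "\<alpha> \<in> expts n D" for i \<alpha>
      using LIMSEQ_subseq_LIMSEQ[OF lim_h[OF that] s_mono] by (simp add: comp_def)
    have lim_qs: "(\<lambda>k. displ (h (s k)) i \<alpha> / c (s k)) \<longlonglongrightarrow> q i \<alpha>" if "i \<le> n" "\<alpha> \<in> expts n (Suc D)" for i \<alpha>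
      using LIMSEQ_subseq_LIMSEQ[OF lim_q[OF that] s_mono] by (simp add: comp_def)
    have mus: "k \<le> \<mu> (s k)" for k using seq_suble[OF s_mono, of k] mu[of "s k"] by simp
    have "tnorm n D A = 1"
      by (rule limit_coeffs_propto_id(1)[OF conv G id mus h' lim_A])
    moreover have "pval n D (A i) x * x 0 = pval n D (A 0) x * x i" if "i \<le> n" for i x
      by (rule limit_coeffs_propto_id(2)[OF conv G id mus h' lim_A that])
    moreover have "norm (Q i \<alpha>) \<le> 2" if "i \<le> n" "\<alpha> \<in> expts n (Suc D)" for i \<alpha>
      by (rule Lim_norm_ubound[OF _ lim_Q[OF that]]) (use Q_bound[OF that] in auto)
    moreover have "pval n D (l 0) x * pval n (Suc D) (Q i) x
        = of_nat K * pval n D (A 0) x * pval n (Suc D) (q i) x"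
      if "i \<le> n" "x 0 \<noteq> 0" "pval n D (l 0) x \<noteq> 0" for x i
      by (rule iterate_displacement[OF h(1,2) h'(1,2) iter lim_hs lim_A lim_qs lim_Q l_id that(2,3,1)])
    ultimately have "good K A Q" unfolding good_def by blast
    then show ?thesis by blast
  qed
  then obtain A Q where good: "\<And>K. good K (A K) (Q K)" by metis
  have A1: "tnorm n D (A K) = 1" for K using good[of K] by (simp add: good_def)
  have A_id: "pval n D (A K i) x * x 0 = pval n D (A K 0) x * x i" if "i \<le> n" for K i x
    using good[of K] that unfolding good_def by blast
  have Q2: "norm (Q K i \<alpha>) \<le> 2" if "i \<le> n" "\<alpha> \<in> expts n (Suc D)" for K i \<alpha>
    using good[of K] that unfolding good_def by blast
  have AQ: "pval n D (l 0) x * pval n (Suc D) (Q K i) x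
      = of_nat K * pval n D (A K 0) x * pval n (Suc D) (q i) x"
    if "i \<le> n" "x 0 \<noteq> 0" "pval n D (l 0) x \<noteq> 0" for K x i
    using good[of K] that unfolding good_def by blast
  have A_bound: "norm (A K i \<alpha>) \<le> 1" if "i \<le> n" "\<alpha> \<in> expts n D" for K i \<alpha>
    using norm_le_tnorm[OF that, of "A K"] A1 by simp
  \<comment> \<open>A further limit, now as the exponent grows. Unit norm of \<open>A K\<close>
    again keeps the limit \<open>B\<close> nonzero.\<close>
  obtain s B where s: "strict_mono s"
    and lim_B: "\<And>i \<alpha>. i \<le> n \<Longrightarrow> \<alpha> \<in> expts n D \<Longrightarrow> (\<lambda>k. A (s k) i \<alpha>) \<longlonglongrightarrow> B i \<alpha>"
    using tuples_convergent_subseq[of n D A 1, OF A_bound] by blast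
  have B1: "tnorm n D B = 1"
    using tendsto_tnorm[of n D "\<lambda>k. A (s k)" B sequentially, OF lim_B] by (simp add: A1 LIMSEQ_const_iff)
  have B_lim: "(\<lambda>k. pval n D (A (s k) i) x) \<longlonglongrightarrow> pval n D (B i) x" if "i \<le> n" for i x
    using that by (intro tendsto_pval lim_B tendsto_const)
  have B_id: "pval n D (B i) x * x 0 = pval n D (B 0) x * x i" if "i \<le> n" for i x
  proof (rule LIMSEQ_unique)
    show "(\<lambda>k. pval n D (A (s k) i) x * x 0) \<longlonglongrightarrow> pval n D (B i) x * x 0"
      by (intro tendsto_mult B_lim that tendsto_const)
    show "(\<lambda>k. pval n D (A (s k) i) x * x 0) \<longlonglongrightarrow> pval n D (B 0) x * x i"
      unfolding A_id[OF that] by (intro tendsto_mult B_lim le0 tendsto_const)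
  qed
  have q1: "tnorm n (Suc D) q = 1"
  proof (rule LIMSEQ_unique)
    show "(\<lambda>k. tnorm n (Suc D) (\<lambda>i \<alpha>. displ (h k) i \<alpha> / c k)) \<longlonglongrightarrow> tnorm n (Suc D) q"
      by (rule tendsto_tnorm[OF lim_q])
    have "tnorm n (Suc D) (\<lambda>i \<alpha>. displ (h k) i \<alpha> / c k) = 1" for k
      using tnorm_scale[of n "Suc D" "inverse (c k)" "displ (h k)"] c[of k]
      by (simp add: divide_inverse mult.commute norm_inverse \<delta>_def[symmetric])
    then show "(\<lambda>k. tnorm n (Suc D) (\<lambda>i \<alpha>. displ (h k) i \<alpha> / c k)) \<longlonglongrightarrow> 1" by simp
  qed
  then obtain i \<alpha> where i: "i \<le> n" "\<alpha> \<in> expts n (Suc D)" "q i \<alpha> \<noteq> 0"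
    using tnorm_pos_obtain[of n "Suc D" q] by auto
  obtain x1 where x1: "pval n (Suc D) (q i) x1 \<noteq> 0" using pval_nonzero[of \<alpha> n "Suc D" "q i"] i by blast
  obtain x2 where x2: "pval n D (l 0) x2 \<noteq> 0"
    using propto_id_first_coord_nonzero[of n D l] l_id l1 by auto
  obtain x3 where x3: "pval n D (B 0) x3 \<noteq> 0"
    using propto_id_first_coord_nonzero[of n D B] B_id B1 by auto
  \<comment> \<open>Four polynomials, each nonzero somewhere, are combined in pairs to find one
    point where none of them vanishes.\<close>
  from polyfun_common_nonzero[OF polyfun_pval polyfun_pval x1 x2]
  obtain x4 where x4: "pval n (Suc D) (q i) x4 * pval n D (l 0) x4 \<noteq> 0" by auto
  from polyfun_common_nonzero[OF polyfun_pval polyfun.coord[of 0] x3, of "\<lambda>_. 1"]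
  obtain x5 where x5: "pval n D (B 0) x5 * x5 0 \<noteq> 0" by auto
  from polyfun_common_nonzero[OF polyfun.mult[OF polyfun_pval polyfun_pval]
      polyfun.mult[OF polyfun_pval polyfun.coord] x4 x5]
  obtain z where z: "pval n (Suc D) (q i) z \<noteq> 0" "pval n D (l 0) z \<noteq> 0" "pval n D (B 0) z \<noteq> 0" "z 0 \<noteq> 0"
    by auto
  define u where "u k = pval n D (A (s k) 0) z * pval n (Suc D) (q i) z" for k
  \<comment> \<open>Bounds the left-hand side of \<open>AQ\<close> at \<open>z\<close> uniformly in
    the exponent, since the coefficients of \<open>Q\<close> have norm at most 2.\<close>
  define C where "C = norm (pval n D (l 0) z) * (2 * (\<Sum>\<alpha>\<in>expts n (Suc D). norm (\<Prod>i\<le>n. z i ^ \<alpha> i)))"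
  have u_bound: "norm (u k) \<le> C / of_nat k" if "k > 0" for k
  proof -
    have "real k * norm (u k) \<le> real (s k) * norm (u k)"
      using seq_suble[OF s, of k] by (intro mult_right_mono) auto
    also have "\<dots> = norm (of_nat (s k) * pval n D (A (s k) 0) z * pval n (Suc D) (q i) z)"
      by (simp add: u_def norm_mult)
    also have "\<dots> = norm (pval n D (l 0) z) * norm (pval n (Suc D) (Q (s k) i) z)"
      by (simp add: AQ[OF i(1) z(4,2), symmetric] norm_mult)
    also have "\<dots> \<le> C"
      unfolding C_def by (intro mult_left_mono norm_pval_le Q2 i(1)) auto
    finally show ?thesis using that by (simp add: field_simps)
  qed
  \<comment> \<open>The product of \<open>u k\<close> with the growing exponent \<open>s k\<close>
    stays bounded, so \<open>u\<close> tends to zero, whereas its other limit is nonzero by the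
    choice of \<open>z\<close>.\<close>
  have "u \<longlonglongrightarrow> 0"
    by (rule Lim_null_comparison[OF _ lim_const_over_n[of C]])
       (use u_bound in \<open>auto simp: eventually_sequentially intro!: exI[of _ 1]\<close>)
  moreover have "u \<longlonglongrightarrow> pval n D (B 0) z * pval n (Suc D) (q i) z"
    unfolding u_def[abs_def] by (intro tendsto_mult B_lim tendsto_const le0)
  ultimately have "pval n D (B 0) z * pval n (Suc D) (q i) z = 0" using LIMSEQ_unique by blast
  then show False using z by simp
qed

theorem theorem1p2:
  fixes n :: nat
  assumes "1 \<le> n"
  shows "(\<forall>G :: nat \<Rightarrow> real bir set.
            (\<forall>m. subgroup (G m) (BirG n)) \<and> converges_to_id n G
            \<longrightarrow> (\<exists>m0. \<forall>m\<ge>m0. G m = {bid n}))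
       \<and> (\<forall>G :: nat \<Rightarrow> complex bir set.
            (\<forall>m. subgroup (G m) (BirG n)) \<and> converges_to_id n G
            \<longrightarrow> (\<exists>m0. \<forall>m\<ge>m0. G m = {bid n}))"
  by (intro conjI allI impI subgroups_converging_to_id_trivial) auto

end
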